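(* Fix $d\in\{2,3\}$, $T,\gamma>0$, and $x\in\mathbb R^d\setminus\{0\}$. Let $\tau:=\inf\{t\in[0,T]:X_t=0\}$, with $\inf\varnothing=\infty$. The following hold. (i) The probability that the ground-state diffusion does not hit the origin by time $T$ is $$\mathbb P_x^{T,\gamma}[\tau>T]=\frac{K_{d/2-1}\big(\sqrt{2\lambda_\gamma}\,|x|,\lambda_\gamma T\big)}{K_{d/2-1}\big(\sqrt{2\lambda_\gamma}\,|x|\big)}.$$ (ii) Conditionally on the event $\{\tau\le T\}$, the first hitting time $\tau$ has density on $(0,T]$ given by $$\frac{\mathbb P_x^{T,\gamma}[\tau\in dt\mid\tau\le T]}{dt}=\frac{\left(\frac{|x|}{\sqrt{2\lambda_\gamma}}\right)^{d/2-1}}{K_{d/2-1}\big(\sqrt{2\lambda_\gamma}|x|\big)-K_{d/2-1}\big(\sqrt{2\lambda_\gamma}|x|,\lambda_\gamma T\big)}\,\frac{1}{2t^{d/2}}\,e^{-\lambda_\gamma t-\frac{|x|^2}{2t}},\qquad 0<t\le T.$$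
   Context: Bessel functions: for $\nu\in\mathbb R$, $z>0$, $y\ge0$, the incomplete modified Bessel function of the second kind is $K_\nu(z,y)=\frac12(\frac z2)^\nu\int_y^\infty u^{-\nu-1}e^{-u-\frac{z^2}{4u}}du$, and $K_\nu(z)=K_\nu(z,0)$. Free heat kernel: $g_t(z)=(2\pi t)^{-d/2}e^{-|z|^2/(2t)}$ on $\mathbb R^d$. Let $\lambda_\gamma=\gamma$ if $d=2$, $\lambda_\gamma=\gamma^2/2$ if $d=3$, and for $x\neq0$ let $\psi_\gamma(x)=\sqrt{2\gamma/\pi}\,K_0(\sqrt{2\gamma}|x|)$ if $d=2$, $\psi_\gamma(x)=\sqrt{\gamma/(2\pi)}\,e^{-\gamma|x|}/|x|$ if $d=3$. Point-interaction kernel: $p_t^\gamma(x,y)=g_t(x-y)+h_t^\gamma(x,y)$ for $t>0$, $x,y\in\mathbb R^d\setminus\{0\}$, where for $d=2$ $$h_t^\gamma(x,y)=2\pi\gamma\int_{0<r<s<t}g_r(x)\,\nu'(\gamma(s-r))\,g_{t-s}(y)\,ds\,dr,\qquad \nu(a)=\int_0^\infty\frac{a^s}{\Gamma(s+1)}ds,$$ and for $d=3$ $$h_t^\gamma(x,y)=\frac{t}{|x||y|}\bar g_t(|x|+|y|)+\frac{\gamma t}{|x||y|}\int_0^\infty e^{\gamma u}\bar g_t(u+|x|+|y|)\,du,\qquad \bar g_t(r)=(2\pi t)^{-3/2}e^{-r^2/(2t)}.$$ Transition density: $q_t^\gamma(x,y)=e^{-\lambda_\gamma t}\frac{\psi_\gamma(y)}{\psi_\gamma(x)}p_t^\gamma(x,y)$.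 Ground-state diffusion: $\Omega=C([0,T];\mathbb R^d)$ with the uniform metric and Borel $\sigma$-algebra $\mathcal B(\Omega)$, $X_t(\omega)=\omega(t)$, $\mathcal F_t=\sigma(X_s:0\le s\le t)$. It is known that for $x\ne0$ there is a unique probability measure $\mathbb P_x^{T,\gamma}$ on $(\Omega,\mathcal B(\Omega))$ under which $X_0=x$ a.s. and $X$ is a time-homogeneous Markov process with respect to $\{\mathcal F_t\}_{t\in[0,T]}$ with transition density $q_t^\gamma$. *)

theory Defs
  imports "HOL-Probability.Probability"
begin

section \<open>Incomplete modified Bessel functions of the second kind\<close>

definition inc_bessel_K :: "real \<Rightarrow> real \<Rightarrow> real \<Rightarrow> real" where
  "inc_bessel_K \<nu> z y =
     1 / 2 * (z / 2) powr \<nu> *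
       (LBINT u:{y<..}. u powr (- \<nu> - 1) * exp (- u - z\<^sup>2 / (4 * u)))"

definition bessel_K :: "real \<Rightarrow> real \<Rightarrow> real" where
  "bessel_K \<nu> z = inc_bessel_K \<nu> z 0"


section \<open>Point-interaction kernel and ground-state transition density\<close>

text \<open>
  The ambient space is \<open>'a\<close> with \<open>DIM('a) \<in> {2, 3}\<close>. The definitions distinguishing the two
  cases test for dimension 2; their other branch is the three-dimensional formula. The kernels
  are meaningful only for positive times and nonzero spatial arguments.
\<close>

definition free_heat :: "real \<Rightarrow> 'a::euclidean_space \<Rightarrow> real" where
  "free_heat t z = (2 * pi * t) powr (- (real DIM('a) / 2)) * exp (- (norm z)\<^sup>2 / (2 * t))"

definition ground_energy :: "nat \<Rightarrow> real \<Rightarrow> real" where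
  "ground_energy d \<gamma> = (if d = 2 then \<gamma> else \<gamma>\<^sup>2 / 2)"

definition ground_state :: "real \<Rightarrow> 'a::euclidean_space \<Rightarrow> real" where
  "ground_state \<gamma> x =
     (if DIM('a) = 2 then sqrt (2 * \<gamma> / pi) * bessel_K 0 (sqrt (2 * \<gamma>) * norm x)
      else sqrt (\<gamma> / (2 * pi)) * (exp (- \<gamma> * norm x) / norm x))"

definition volterra_nu :: "real \<Rightarrow> real" where
  "volterra_nu a = (LBINT s:{0<..}. a powr s / Gamma (s + 1))"

definition interaction_2 :: "real \<Rightarrow> real \<Rightarrow> 'a::euclidean_space \<Rightarrow> 'a \<Rightarrow> real" where
  "interaction_2 \<gamma> t x y =
     2 * pi * \<gamma> *
       (LINT rs:{(r, s). 0 < r \<and> r < s \<and> s < t}|(lborel :: (real \<times> real) measure).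
          free_heat (fst rs) x * deriv volterra_nu (\<gamma> * (snd rs - fst rs))
            * free_heat (t - snd rs) y)"

definition radial_heat_3 :: "real \<Rightarrow> real \<Rightarrow> real" where
  "radial_heat_3 t r = (2 * pi * t) powr (- (3 / 2)) * exp (- r\<^sup>2 / (2 * t))"

definition interaction_3 :: "real \<Rightarrow> real \<Rightarrow> 'a::euclidean_space \<Rightarrow> 'a \<Rightarrow> real" where
  "interaction_3 \<gamma> t x y =
     t / (norm x * norm y) * radial_heat_3 t (norm x + norm y) +
     \<gamma> * t / (norm x * norm y) *
       (LBINT u:{0<..}. exp (\<gamma> * u) * radial_heat_3 t (u + norm x + norm y))"

definition point_kernel :: "real \<Rightarrow> real \<Rightarrow> 'a::euclidean_space \<Rightarrow> 'a \<Rightarrow> real" where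
  "point_kernel \<gamma> t x y =
     free_heat t (x - y) +
     (if DIM('a) = 2 then interaction_2 \<gamma> t x y else interaction_3 \<gamma> t x y)"

definition ground_density :: "real \<Rightarrow> real \<Rightarrow> 'a::euclidean_space \<Rightarrow> 'a \<Rightarrow> real" where
  "ground_density \<gamma> t x y =
     exp (- ground_energy DIM('a) \<gamma> * t) * (ground_state \<gamma> y / ground_state \<gamma> x)
       * point_kernel \<gamma> t x y"


section \<open>Path space and the ground-state diffusion\<close>

text \<open>
  \<open>cfunspace\<close> carries the supremum metric. Its points are functions on \<open>real\<close> that are
  continuous on \<open>{0..T}\<close> and equal to \<open>undefined\<close> elsewhere; the boundedness
  that \<open>cfunspace\<close> also requires is automatic by compactness.
\<close>

definition path_metric :: "real \<Rightarrow> (real \<Rightarrow> 'a::euclidean_space) metric" where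
  "path_metric T = cfunspace (top_of_set {0..T}) euclidean_metric"

definition path_borel :: "real \<Rightarrow> (real \<Rightarrow> 'a::euclidean_space) measure" where
  "path_borel T = sigma (mspace (path_metric T)) {U. openin (mtopology_of (path_metric T)) U}"

definition path_filtration :: "real \<Rightarrow> real \<Rightarrow> (real \<Rightarrow> 'a::euclidean_space) measure" where
  "path_filtration T t =
     sigma (mspace (path_metric T))
       {{\<omega> \<in> mspace (path_metric T). \<omega> s \<in> B} | s B. 0 \<le> s \<and> s \<le> t \<and> B \<in> sets borel}"

text \<open>
  A measure \<open>P\<close> on path space is the law of the ground-state diffusion started at \<open>x\<close> if the
  coordinate process starts at \<open>x\<close> almost surely and is a time-homogeneous Markov process for
  its natural filtration with transition density \<open>ground_density \<gamma>\<close>. The density is not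
  meaningful at the origin, which does not matter below: as an integration point the origin is
  Lebesgue-null, and as a starting point it has probability zero at each fixed time, since
  \<open>x \<noteq> 0\<close> and the law at each positive time is absolutely continuous.
\<close>

definition ground_state_diffusion ::
    "real \<Rightarrow> real \<Rightarrow> 'a::euclidean_space \<Rightarrow> (real \<Rightarrow> 'a) measure \<Rightarrow> bool" where
  "ground_state_diffusion T \<gamma> x P \<longleftrightarrow>
     prob_space P \<and> space P = space (path_borel T) \<and> sets P = sets (path_borel T) \<and>
     (AE \<omega> in P. \<omega> 0 = x) \<and>
     (\<forall>s t B. 0 \<le> s \<and> s < t \<and> t \<le> T \<and> B \<in> sets borel \<longrightarrow>
        (AE \<omega> in P.
           real_cond_exp P (path_filtration T s) (\<lambda>\<omega>'. indicator B (\<omega>' t)) \<omega> =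
             (LBINT y:B. ground_density \<gamma> (t - s) (\<omega> s) y)))"

text \<open>The infimum is taken in \<open>ereal\<close>, where \<open>Inf {} = \<infinity>\<close>.\<close>

definition hitting_time :: "real \<Rightarrow> (real \<Rightarrow> 'a::euclidean_space) \<Rightarrow> ereal" where
  "hitting_time T \<omega> = Inf (ereal ` {t \<in> {0..T}. \<omega> t = 0})"

end

theory Submission
  imports Defs
begin

text \<open>
  Put \<open>u\<^sub>s(y) = W\<^sub>s(|y|) / W\<^sub>0(|y|)\<close> with
  \<open>W\<^sub>s(a) = \<integral>\<^sub>s\<^sup>\<infinity> r powr (-d/2) exp (-\<lambda>r - a\<^sup>2/(2r)) dr\<close>. The ground state is a multiple of \<open>W\<^sub>0\<close>,
  that is, of the resolvent kernel of Brownian motion, so the part of the transition density coming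
  from the free heat kernel maps \<open>u\<^sub>s\<close> to \<open>u\<^sub>s\<^sub>+\<^sub>t\<close> by the semigroup property. The remaining part, coming
  from the interaction kernel, is nonnegative, and by conservativity its mass is
  \<open>1 - u\<^sub>t(y)\<close>, which is \<open>O(t\<^sup>2)\<close> uniformly away from the origin. Hence \<open>u\<^bsub>t-s\<^esub>(X\<^sub>s)\<close>,
  sampled on a grid of mesh \<open>\<delta>\<close> and stopped on entering a small ball around the origin, is a
  martingale up to a total error \<open>O(\<delta>)\<close>. As \<open>W\<^sub>0\<close> blows up at the origin, it is small in that
  ball as long as \<open>s\<close> stays away from \<open>t\<close>, and \<open>u\<^sub>0 = 1\<close>; refining the grid and shrinking the
  ball gives \<open>P(\<tau> > t) = u\<^sub>t(x)\<close>. The explicit interaction kernel enters only through its sign.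
\<close>

section \<open>Nonnegativity of the interaction kernel\<close>

text \<open>Brownian motion in dimension at least two does not hit the origin, so killing it there
  leaves the heat kernel unchanged. Hitting by the ground-state diffusion therefore shows up
  entirely as mass missing from the transform of the heat kernel by \<open>W\<^sub>0\<close>. The
  sign of the interaction gives only a lower bound on the transition density. The missing upper
  bound is replaced by testing this one inequality against both \<open>u\<^sub>r\<close> and
  \<open>1 - u\<^sub>r\<close>. Conservativity is not integrated out of the explicit kernels: it is
  read off the Markov property with \<open>B = UNIV\<close>, almost surely along the path, and also
  certifies that the density is integrable there. The two directions differ in time. The upper
  estimate runs up to \<open>t\<close> itself, whereas the lower one stops at some
  \<open>S < t\<close>, since \<open>u\<^sub>0\<close> is not small near the origin. The gap closes
  by letting \<open>S\<close> tend to \<open>t\<close>, because the path is almost surely nonzero at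
  the fixed time \<open>t\<close>.\<close>

lemma Gamma_lower_bound:
  assumes R: "0 < (R::real)" and s: "0 \<le> s"
  shows "R powr s * exp (- R) \<le> Gamma (s + 1)"
proof -
  have 1: "((\<lambda>t. t powr s / exp t) has_integral Gamma (s + 1)) {0..}"
    using Gamma_integral_real[of "s + 1"] s by simp
  have 2: "((\<lambda>t. exp (- 1 * t)) has_integral exp (- 1 * R) / 1) {R..}"
    by (rule has_integral_exp_minus_to_infinity) simp
  have 3: "((\<lambda>t. R powr s * exp (- t)) has_integral R powr s * exp (- R)) {R..}"
    using has_integral_mult_right[OF 2, of "R powr s"] by simp
  have 4: "((\<lambda>t. if t \<in> {R..} then R powr s * exp (- t) else 0) has_integral R powr s * exp (- R)) {0..}"
    using 3 R by (subst has_integral_restrict) auto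
  show ?thesis
    using R s by (intro has_integral_le[OF 4 1])
      (simp_all add: exp_minus divide_inverse mult_right_mono powr_mono2)
qed

text \<open>Differentiation under the integral sign: the mean value theorem bounds every difference
  quotient by \<open>g\<close>, and dominated convergence along sequences does the rest.\<close>

lemma has_field_derivative_lebesgue_integral:
  fixes f f' :: "real \<Rightarrow> 'b \<Rightarrow> real"
  assumes e: "0 < e"
    and int: "\<And>y. \<bar>y - a\<bar> < e \<Longrightarrow> integrable M (f y)"
    and deriv: "\<And>y s. \<bar>y - a\<bar> < e \<Longrightarrow> s \<in> space M \<Longrightarrow> ((\<lambda>y. f y s) has_real_derivative f' y s) (at y)"
    and bound: "\<And>y s. \<bar>y - a\<bar> < e \<Longrightarrow> s \<in> space M \<Longrightarrow> \<bar>f' y s\<bar> \<le> g s"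
    and meas: "f' a \<in> borel_measurable M"
    and g: "integrable M g"
  shows "((\<lambda>y. LINT s|M. f y s) has_real_derivative (LINT s|M. f' a s)) (at a)"
  unfolding has_field_derivative_iff
proof (rule LIMSEQ_SEQ_conv[THEN iffD1], intro allI impI)
  fix S :: "nat \<Rightarrow> real" assume "(\<forall>n. S n \<noteq> a) \<and> S \<longlonglongrightarrow> a"
  then have ne: "\<And>n. S n \<noteq> a" and lim: "S \<longlonglongrightarrow> a" by auto
  \<comment> \<open>Derivative and bound are available only within distance \<open>e\<close> of
    \<open>a\<close>, so the sequence is shifted by \<open>N\<close>; \<open>LIMSEQ_offset\<close>
    undoes the shift at the end.\<close>
  from LIMSEQ_D[OF lim e] obtain N where N: "\<And>n. n \<ge> N \<Longrightarrow> \<bar>S n - a\<bar> < e"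
    unfolding real_norm_def by blast
  have int_S: "integrable M (f (S (n + N)))" for n
    by (rule int[OF N]) simp
  have a: "\<bar>a - a\<bar> < e" using e by simp
  note int_a = int[OF a]
  have quot: "\<bar>(f (S (n + N)) s - f a s) / (S (n + N) - a)\<bar> \<le> g s" if s: "s \<in> space M" for n s
  proof -
    let ?y = "S (n + N)"
    have y: "\<bar>?y - a\<bar> < e" by (rule N) simp
    have "norm (f ?y s - f a s) \<le> g s * norm (?y - a)"
    proof (rule field_differentiable_bound[where S = "{a - e<..<a + e}" and f = "\<lambda>y. f y s" and x = ?y and y = a and f' = "\<lambda>y. f' y s"])
      fix z assume "z \<in> {a - e<..<a + e}"
      then have z: "\<bar>z - a\<bar> < e" by auto
      show "((\<lambda>y. f y s) has_real_derivative f' z s) (at z within {a - e<..<a + e})"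
        by (rule has_field_derivative_at_within[OF deriv[OF z s]])
      show "norm (f' z s) \<le> g s"
        using bound[OF z s] by simp
    next
      show "?y \<in> {a - e<..<a + e}" "a \<in> {a - e<..<a + e}"
        using y e unfolding greaterThanLessThan_iff by linarith+
    qed (rule convex_real_interval)
    moreover have "0 < \<bar>?y - a\<bar>" using ne[of "n + N"] by simp
    ultimately show ?thesis
      unfolding abs_divide real_norm_def by (subst pos_divide_le_eq)
  qed
  have "(\<lambda>n. LINT s|M. (f (S (n + N)) s - f a s) / (S (n + N) - a)) \<longlonglongrightarrow> (LINT s|M. f' a s)"
  proof (rule integral_dominated_convergence[where w=g])
    show "(\<lambda>s. (f (S (n + N)) s - f a s) / (S (n + N) - a)) \<in> borel_measurable M" for n
      using int_S int_a by simp
    show "AE s in M. (\<lambda>n. (f (S (n + N)) s - f a s) / (S (n + N) - a)) \<longlonglongrightarrow> f' a s"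
    proof (rule AE_I2)
      fix s assume s: "s \<in> space M"
      have "(\<lambda>y. (f y s - f a s) / (y - a)) \<midarrow>a\<rightarrow> f' a s"
        using deriv[OF a s] by (simp add: has_field_derivative_iff)
      from LIMSEQ_SEQ_conv[THEN iffD2, OF this, THEN spec, THEN mp, of S]
      have "(\<lambda>n. (f (S n) s - f a s) / (S n - a)) \<longlonglongrightarrow> f' a s"
        using ne lim by simp
      then show "(\<lambda>n. (f (S (n + N)) s - f a s) / (S (n + N) - a)) \<longlonglongrightarrow> f' a s"
        by (rule LIMSEQ_ignore_initial_segment)
    qed
    show "AE s in M. norm ((f (S (n + N)) s - f a s) / (S (n + N) - a)) \<le> g s" for n
      unfolding real_norm_def by (intro AE_I2 quot)
  qed (fact meas g)+
  moreover have "(LINT s|M. (f (S (n + N)) s - f a s) / (S (n + N) - a)) =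
      ((LINT s|M. f (S (n + N)) s) - (LINT s|M. f a s)) / (S (n + N) - a)" for n
    using int_S int_a by simp
  ultimately have "(\<lambda>n. ((LINT s|M. f (S (n + N)) s) - (LINT s|M. f a s)) / (S (n + N) - a))
      \<longlonglongrightarrow> (LINT s|M. f' a s)" by (simp only:)
  then show "(\<lambda>n. ((LINT s|M. f (S n) s) - (LINT s|M. f a s)) / (S n - a)) \<longlonglongrightarrow> (LINT s|M. f' a s)"
    by (rule LIMSEQ_offset)
qed

lemma set_integrable_exp_decay:
  assumes l: "0 < l" and s: "0 \<le> s"
  shows "set_integrable lborel {s<..} (\<lambda>r::real. exp (- l * r))"
proof -
  have "((\<lambda>r. exp (- l * r)) has_integral exp (- l * 0) / l) {0..}"
    by (rule has_integral_exp_minus_to_infinity) fact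
  then have "(\<lambda>r. exp (- l * r)) absolutely_integrable_on {0..}"
    by (intro nonnegative_absolutely_integrable_1) auto
  then have "set_integrable lborel {0..} (\<lambda>r. exp (- l * r))"
    by (simp add: set_integrable_def integrable_completion)
  then show ?thesis using s by (rule_tac set_integrable_subset) auto
qed

text \<open>On the positive half-line \<open>s + 1\<close> is never a pole of \<open>Gamma\<close>,
  so continuity there gives measurability. The factor \<open>g\<close> is left open to cover both
  the integrand of \<open>volterra_nu\<close> and its derivative in the parameter.\<close>

lemma volterra_integrand_measurable [measurable]:
  "(\<lambda>s. indicator {0<..} s * (g s / Gamma (s + 1 :: real))) \<in> borel_measurable borel"
  if [measurable]: "g \<in> borel_measurable borel"
proof -
  have "continuous_on {0::real<..} (\<lambda>s. 1 / Gamma (s + 1))"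
    by (intro continuous_on_divide continuous_on_compose2[OF continuous_on_Gamma, of "{0<..}"] continuous_intros)
       (auto simp: Gamma_eq_zero_iff elim!: nonpos_Ints_cases)
  then have [measurable]: "(\<lambda>s. indicator {0<..} s *\<^sub>R (1 / Gamma (s + 1 :: real))) \<in> borel_measurable borel"
    by (intro borel_measurable_continuous_on_indicator) auto
  have "(\<lambda>s. (indicator {0<..} s *\<^sub>R (1 / Gamma (s + 1 :: real))) * g s) \<in> borel_measurable borel"
    by measurable
  then show ?thesis by (simp add: field_simps)
qed

lemma volterra_majorant_integrable:
  assumes b: "0 < (b::real)"
  shows "integrable lborel (\<lambda>s. indicator {0<..} s * (b powr s / Gamma (s + 1)))"
proof (rule Bochner_Integration.integrable_bound)
  \<comment> \<open>\<open>Gamma_lower_bound\<close> holds for every base \<open>R\<close>. With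
    this choice \<open>?R powr s\<close> equals \<open>b powr s * exp s\<close>, which absorbs the
    growth of \<open>b powr s\<close> and leaves the decay \<open>exp (- s)\<close>.\<close>
  let ?R = "b * exp 1"
  show "integrable lborel (\<lambda>s. exp ?R * (indicator {0<..} s *\<^sub>R exp (- s)))"
    using set_integrable_exp_decay[of 1 0] by (simp add: set_integrable_def)
  show "AE s in lborel. norm (indicator {0<..} s * (b powr s / Gamma (s + 1)))
      \<le> norm (exp ?R * (indicator {0<..} s *\<^sub>R exp (- s)))"
  proof (rule AE_I2)
    fix s :: real
    have "b powr s / Gamma (s + 1) \<le> exp ?R * exp (- s)" if s: "0 < s"
    proof -
      have "?R powr s * exp (- ?R) \<le> Gamma (s + 1)"
        using b s by (intro Gamma_lower_bound) auto
      moreover have "?R powr s = b powr s * exp s"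
        using b by (simp add: powr_def ln_mult ring_distribs exp_add)
      ultimately have "b powr s * (exp s * exp (- ?R)) \<le> Gamma (s + 1)"
        by (simp add: mult.assoc)
      moreover have "0 < Gamma (s + 1)" using s by (intro Gamma_real_pos) auto
      ultimately show ?thesis
        by (simp add: divide_le_eq exp_minus field_simps)
    qed
    moreover have "0 < Gamma (s + 1)" if "0 < s" using that by (intro Gamma_real_pos) auto
    ultimately show "norm (indicator {0<..} s * (b powr s / Gamma (s + 1)))
      \<le> norm (exp ?R * (indicator {0<..} s *\<^sub>R exp (- s)))"
      by (auto simp: indicator_def abs_mult)
  qed
qed measurable

text \<open>\<open>deriv\<close> carries information only where the derivative exists, so
  differentiability of \<open>volterra_nu\<close> has to be proved first; the differentiated
  integrand is then visibly nonnegative.\<close>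

lemma deriv_volterra_nu_nonneg:
  assumes a: "0 < a"
  shows "0 \<le> deriv volterra_nu a"
proof -
  let ?f = "\<lambda>y s::real. indicator {0<..} s * (y powr s / Gamma (s + 1))"
  let ?f' = "\<lambda>y s::real. indicator {0<..} s * (s * y powr (s - 1) / Gamma (s + 1))"
  \<comment> \<open>For \<open>y\<close> between \<open>a / 2\<close> and \<open>2 * a\<close>, this
    combines the bounds \<open>s \<le> exp s\<close>, \<open>y powr s \<le> (2 * a) powr s\<close>
    and \<open>1 / y \<le> 2 / a\<close>.\<close>
  let ?g = "\<lambda>s::real. 2 / a * (indicator {0<..} s * ((2 * a * exp 1) powr s / Gamma (s + 1)))"
  have Gpos: "0 < Gamma (s + 1)" if "0 < s" for s :: real
    using that by (intro Gamma_real_pos) auto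
  then have Gne: "Gamma (s + 1) \<noteq> 0" if "0 < s" for s :: real
    using that by (metis less_irrefl)
  have "((\<lambda>y. LINT s|lborel. ?f y s) has_real_derivative (LINT s|lborel. ?f' a s)) (at a)"
  proof (rule has_field_derivative_lebesgue_integral[where e="a / 2" and g = ?g])
    fix y :: real assume y: "\<bar>y - a\<bar> < a / 2"
    then have y0: "a / 2 < y" "0 < y" "y < 2 * a" using a by linarith+
    show "integrable lborel (?f y)" by (rule volterra_majorant_integrable) fact
    fix s :: real
    show "((\<lambda>y. ?f y s) has_real_derivative ?f' y s) (at y)"
      using y0 Gne by (auto simp: indicator_def intro!: derivative_eq_intros)
    have "s * y powr (s - 1) \<le> 2 / a * (2 * a * exp 1) powr s" if s: "0 < s"
    proof -
      have "s * y powr (s - 1) = s * (y powr s * (1 / y))"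
        using y0 by (simp add: powr_diff)
      also have "\<dots> \<le> exp s * ((2 * a) powr s * (2 / a))"
      proof (intro mult_mono powr_mono2)
        show "s \<le> exp s" using exp_ge_add_one_self[of s] by linarith
      qed (use y0 s in \<open>auto simp: field_simps\<close>)
      also have "\<dots> = 2 / a * (2 * a * exp 1) powr s"
        using a by (simp add: powr_def ln_mult ring_distribs exp_add)
      finally show ?thesis .
    qed
    then have "s * y powr (s - 1) / Gamma (s + 1) \<le> 2 / a * (2 * a * exp 1) powr s / Gamma (s + 1)"
      if "0 < s" using that Gpos[of s] by (intro divide_right_mono) auto
    then show "\<bar>?f' y s\<bar> \<le> ?g s"
      using Gpos[of s] by (auto simp: indicator_def abs_mult)
  next
    show "?f' a \<in> borel_measurable lborel" by measurable
    show "integrable lborel ?g"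
      using a by (intro integrable_mult_right volterra_majorant_integrable) auto
  qed (use a in auto)
  then have "(volterra_nu has_real_derivative (LINT s|lborel. ?f' a s)) (at a)"
    by (simp add: volterra_nu_def[abs_def] set_lebesgue_integral_def)
  then have "deriv volterra_nu a = (LINT s|lborel. ?f' a s)" by (rule DERIV_imp_deriv)
  moreover have "0 \<le> (LINT s|lborel. ?f' a s)"
    using Gpos by (intro integral_nonneg_AE AE_I2) (auto simp: indicator_def less_imp_le)
  ultimately show ?thesis by simp
qed

text \<open>Pointwise nonnegativity of the integrand suffices: a Bochner integral that fails to
  converge has the value 0.\<close>

lemma interaction_2_nonneg:
  assumes "0 < \<gamma>"
  shows "0 \<le> interaction_2 \<gamma> t x y"
  unfolding interaction_2_def set_lebesgue_integral_def
  using assms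
  by (intro mult_nonneg_nonneg integral_nonneg_AE AE_I2)
     (auto simp: indicator_def free_heat_def intro!: mult_nonneg_nonneg deriv_volterra_nu_nonneg)

lemma interaction_3_nonneg:
  assumes "0 < \<gamma>" "0 < t"
  shows "0 \<le> interaction_3 \<gamma> t x y"
  unfolding interaction_3_def set_lebesgue_integral_def
  using assms
  by (intro add_nonneg_nonneg mult_nonneg_nonneg integral_nonneg_AE AE_I2)
     (auto simp: indicator_def radial_heat_3_def)

lemma free_heat_le_point_kernel:
  assumes "0 < \<gamma>" "0 < t"
  shows "free_heat t (x - y) \<le> point_kernel \<gamma> t x y"
  using interaction_2_nonneg[OF assms(1), of t x y] interaction_3_nonneg[OF assms, of x y]
  by (simp add: point_kernel_def)

section \<open>The Gaussian semigroup\<close>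

lemma free_heat_nonneg [simp]: "0 \<le> free_heat t z"
  by (simp add: free_heat_def)

lemma free_heat_measurable [measurable]:
  assumes [measurable]: "f \<in> borel_measurable M" "g \<in> borel_measurable M"
  shows "(\<lambda>x. free_heat (f x) (g x :: 'a::euclidean_space)) \<in> borel_measurable M"
  unfolding free_heat_def by measurable

text \<open>Reduces the semigroup property in \<open>DIM('a)\<close> dimensions to the convolution
  of one-dimensional centred normal densities of variance \<open>t\<close>.\<close>

lemma free_heat_eq_prod:
  fixes z :: "'a::euclidean_space"
  assumes t: "0 < t"
  shows "free_heat t z = (\<Prod>b\<in>Basis. normal_density 0 (sqrt t) (z \<bullet> b))"
proof -
  have "(\<Prod>b\<in>(Basis :: 'a set). normal_density 0 (sqrt t) (z \<bullet> b)) =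
      (1 / sqrt (2 * pi * t)) ^ DIM('a) * (\<Prod>b\<in>(Basis :: 'a set). exp (- (z \<bullet> b)\<^sup>2 / (2 * t)))"
    using t by (simp add: normal_density_def prod.distrib prod_dividef power_divide)
  also have "(\<Prod>b\<in>(Basis :: 'a set). exp (- (z \<bullet> b)\<^sup>2 / (2 * t))) = exp (- (norm z)\<^sup>2 / (2 * t))"
  proof -
    have "(\<Sum>b\<in>Basis. (z \<bullet> b)\<^sup>2) = (norm z)\<^sup>2"
      by (subst power2_norm_eq_inner, subst euclidean_inner) (simp add: power2_eq_square)
    then show ?thesis
      by (simp add: exp_sum[symmetric] sum_divide_distrib[symmetric] sum_negf)
  qed
  also have "1 / sqrt (2 * pi * t) = (2 * pi * t) powr (- (1 / 2))"
    using t by (simp add: powr_minus_divide powr_half_sqrt)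
  also have "((2 * pi * t) powr (- (1 / 2))) ^ DIM('a) = (2 * pi * t) powr (- (real DIM('a) / 2))"
    using t by (simp add: powr_power)
  finally show ?thesis by (simp add: free_heat_def)
qed

lemma free_heat_convolution:
  fixes x :: "'a::euclidean_space"
  assumes s: "0 < s" and t: "0 < t"
  shows "(\<integral>\<^sup>+y. ennreal (free_heat s (x - y) * free_heat t y) \<partial>lborel) = ennreal (free_heat (s + t) x)"
proof -
  let ?f = "\<lambda>b y. normal_density 0 (sqrt s) (x \<bullet> b - y) * normal_density 0 (sqrt t) y"
  have "(\<integral>\<^sup>+y. ennreal (free_heat s (x - y) * free_heat t y) \<partial>lborel) =
      (\<integral>\<^sup>+y. (\<Prod>b\<in>Basis. ennreal (?f b (y \<bullet> b))) \<partial>lborel)"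
    using s t by (intro nn_integral_cong)
      (simp add: free_heat_eq_prod prod_ennreal prod.distrib inner_diff_left)
  also have "\<dots> = (\<Prod>b\<in>Basis. (\<integral>\<^sup>+y. ennreal (?f b y) \<partial>lborel))"
    by (rule nn_integral_lborel_prod) auto
  also have "\<dots> = (\<Prod>b\<in>Basis. ennreal (normal_density 0 (sqrt (s + t)) (x \<bullet> b)))"
    using fun_cong[OF conv_normal_density_zero_mean[of "sqrt s" "sqrt t"]] s t by simp
  also have "\<dots> = ennreal (free_heat (s + t) x)"
    using s t by (simp add: free_heat_eq_prod prod_ennreal)
  finally show ?thesis .
qed

section \<open>Incomplete Bessel integrals\<close>

text \<open>For \<open>p = DIM('a) / 2\<close>, \<open>a = norm z\<close> and positive
  \<open>r\<close> this is \<open>exp (- l * r) * free_heat r z\<close> up to a power of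
  \<open>2 * pi\<close>. At \<open>a = norm x\<close> it is also the unnormalised density of the
  hitting time.\<close>

definition hit_weight :: "real \<Rightarrow> real \<Rightarrow> real \<Rightarrow> real \<Rightarrow> real" where
  "hit_weight p l a r = r powr (- p) * exp (- l * r - a\<^sup>2 / (2 * r))"

definition tail_weight :: "real \<Rightarrow> real \<Rightarrow> real \<Rightarrow> real \<Rightarrow> real" where
  "tail_weight p l s a = (LBINT r:{s<..}. hit_weight p l a r)"

lemma hit_weight_nonneg [simp]: "0 \<le> hit_weight p l a r"
  by (simp add: hit_weight_def)

lemma hit_weight_measurable [measurable]:
  assumes [measurable]: "f \<in> borel_measurable M" "g \<in> borel_measurable M"
  shows "(\<lambda>x. hit_weight p l (f x) (g x)) \<in> borel_measurable M"
  unfolding hit_weight_def by measurable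

text \<open>The Gaussian factor beats the singularity: \<open>exp (- z) \<le> 27 / z ^ 3\<close>,
  the cube of \<open>z / 3 \<le> exp (z / 3)\<close>, at \<open>z = a\<^sup>2 / (2 * r)\<close>
  yields \<open>r ^ 3\<close>, against at most \<open>r powr (- 2)\<close>; and
  \<open>216 = 27 * 8\<close>. The surviving factor \<open>r\<close> is what makes the survival
  defect quadratic in time.\<close>

lemma hit_weight_le_small:
  assumes p: "p \<le> 2" and l: "0 \<le> l" and r: "0 < r" "r \<le> 1" and a: "a \<noteq> 0"
  shows "hit_weight p l a r \<le> 216 / a ^ 6 * r"
proof -
  let ?z = "a\<^sup>2 / (2 * r)"
  have "exp (- z) \<le> 27 / z ^ 3" if z: "0 < z" for z :: real
  proof -
    have "z / 3 \<le> exp (z / 3)"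
      using exp_ge_add_one_self[of "z / 3"] by linarith
    then have "(z / 3) ^ 3 \<le> exp (z / 3) ^ 3"
      using z by (intro power_mono) auto
    also have "exp (z / 3) ^ 3 = exp z"
      by (simp flip: exp_of_nat_mult)
    finally show ?thesis
      using z by (simp add: exp_minus power_divide divide_simps)
  qed
  from this[of ?z] have "exp (- ?z) \<le> 27 / ?z ^ 3" using r a by simp
  also have "27 / ?z ^ 3 = 216 / a ^ 6 * r ^ 3"
    using r a by (simp add: field_simps power_mult_distrib flip: power_mult)
  finally have 1: "exp (- ?z) \<le> 216 / a ^ 6 * r ^ 3" .
  have "hit_weight p l a r = r powr (- p) * (exp (- l * r) * exp (- ?z))"
    unfolding hit_weight_def by (simp only: diff_conv_add_uminus exp_add)
  also have "\<dots> \<le> r powr (- 2) * (1 * (216 / a ^ 6 * r ^ 3))"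
  proof (intro mult_mono powr_mono')
    show "exp (- l * r) \<le> 1" using l r by simp
  qed (use 1 p r in auto)
  also have "\<dots> = 216 / a ^ 6 * r"
  proof -
    have "r powr (- 2) * r ^ 3 = r"
      using r powr_add[of r "-2" 3] by (simp add: powr_numeral)
    then show ?thesis by (simp add: mult.left_commute)
  qed
  finally show ?thesis .
qed

lemma hit_weight_le_large:
  assumes p: "0 \<le> p" and r: "0 < s" "s \<le> r"
  shows "hit_weight p l a r \<le> s powr (- p) * exp (- l * r)"
  unfolding hit_weight_def using assms
  by (intro mult_mono powr_mono2') auto

lemma set_integrable_hit_weight:
  assumes p: "0 \<le> p" "p \<le> 2" and l: "0 < l" and s: "0 \<le> s" and a: "a \<noteq> 0 \<or> 0 < s"
  shows "set_integrable lborel {s<..} (hit_weight p l a)"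
proof -
  have "\<exists>C. \<forall>r>s. hit_weight p l a r \<le> C * exp (- l * r)"
  proof (cases "0 < s")
    case True
    then show ?thesis using hit_weight_le_large[OF p(1) True] by (metis less_imp_le)
  next
    case False
    then have s: "s = 0" "a \<noteq> 0" using s a by auto
    \<comment> \<open>On \<open>r \<le> 1\<close> the factor \<open>exp l * exp (- l * r)\<close> is
      at least 1; the summand 1 is the constant for \<open>r > 1\<close>, from
      \<open>hit_weight_le_large\<close> with base point 1.\<close>
    have "hit_weight p l a r \<le> (216 / a ^ 6 * exp l + 1) * exp (- l * r)" if r: "0 < r" for r
    proof (cases "r \<le> 1")
      case True
      have "216 / a ^ 6 * r \<le> 216 / a ^ 6 * (exp l * exp (- l * r))"
        using True l r by (intro mult_left_mono) (auto simp: mult_exp_exp intro: order.trans[of _ 1])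
      then show ?thesis
        using hit_weight_le_small[OF p(2) less_imp_le[OF l] r True s(2)] exp_gt_zero[of "- l * r"]
        unfolding distrib_right mult.assoc mult_1_left by linarith
    next
      case False
      then have "hit_weight p l a r \<le> 1 * exp (- l * r)"
        using hit_weight_le_large[of p 1 r l a] p by simp
      also have "\<dots> \<le> (216 / a ^ 6 * exp l + 1) * exp (- l * r)"
        by (intro mult_right_mono) auto
      finally show ?thesis .
    qed
    then show ?thesis using s by blast
  qed
  then obtain C where C: "\<And>r. s < r \<Longrightarrow> hit_weight p l a r \<le> C * exp (- l * r)" by blast
  have "set_integrable lborel {s<..} (\<lambda>r. C * exp (- l * r))"
    using set_integrable_exp_decay[OF l s] by (rule set_integrable_mult_right)
  then show ?thesis
    by (rule set_integrable_bound)
       (auto simp: set_borel_measurable_def intro!: AE_I2 order.trans[OF C])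
qed

text \<open>
  The case distinction avoids the value at \<open>a = 0\<close> of the divergent integral in the denominator.
\<close>

definition survival :: "real \<Rightarrow> real \<Rightarrow> real \<Rightarrow> real \<Rightarrow> real" where
  "survival p l s a = (if a = 0 then 0 else tail_weight p l s a / tail_weight p l 0 a)"

text \<open>Used with \<open>p = DIM('a) / 2\<close>, that is 1 or 3/2. The lower bound on
  \<open>p\<close> makes \<open>tail_weight p l 0\<close> blow up at the origin; the upper bound is
  the range of \<open>hit_weight_le_small\<close>.\<close>

locale weight_params =
  fixes p l :: real
  assumes p: "1 \<le> p" "p \<le> 2" and l: "0 < l"
begin

lemma integrable_tail:
  assumes "0 \<le> s" "a \<noteq> 0 \<or> 0 < s"
  shows "set_integrable lborel {s<..} (hit_weight p l a)"
  using set_integrable_hit_weight[of p l s a] assms p l by auto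

lemma integrable_tail_subset:
  assumes "0 \<le> s" "a \<noteq> 0 \<or> 0 < s" "A \<subseteq> {s<..}" "A \<in> sets borel"
  shows "set_integrable lborel A (hit_weight p l a)"
  using integrable_tail[OF assms(1,2)] by (rule set_integrable_subset) (use assms in auto)

lemma tail_weight_nonneg: "0 \<le> tail_weight p l s a"
  unfolding tail_weight_def set_lebesgue_integral_def
  by (intro integral_nonneg_AE AE_I2) simp

lemma ennreal_tail_weight:
  assumes "0 \<le> s" "a \<noteq> 0 \<or> 0 < s"
  shows "ennreal (tail_weight p l s a) = (\<integral>\<^sup>+r. ennreal (hit_weight p l a r) * indicator {s<..} r \<partial>lborel)"
  using integrable_tail[OF assms]
  unfolding tail_weight_def set_lebesgue_integral_def set_integrable_def
  by (subst nn_integral_eq_integral[symmetric])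
     (auto intro!: nn_integral_cong split: split_indicator)

lemma tail_weight_diff:
  assumes "0 \<le> s" "s \<le> t" "a \<noteq> 0 \<or> 0 < s"
  shows "tail_weight p l s a - tail_weight p l t a = (LBINT r:{s<..t}. hit_weight p l a r)"
proof -
  have "(LBINT r:{s<..t} \<union> {t<..}. hit_weight p l a r) =
      (LBINT r:{s<..t}. hit_weight p l a r) + (LBINT r:{t<..}. hit_weight p l a r)"
    using assms by (intro set_integral_Un integrable_tail_subset[of s]) auto
  moreover have "{s<..t} \<union> {t<..} = {s<..}" using assms by auto
  ultimately show ?thesis by (simp add: tail_weight_def)
qed

lemma tail_weight_antimono:
  assumes "0 \<le> s" "s \<le> t" "a \<noteq> 0 \<or> 0 < s"
  shows "tail_weight p l t a \<le> tail_weight p l s a"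
proof -
  have "0 \<le> (LBINT r:{s<..t}. hit_weight p l a r)"
    unfolding set_lebesgue_integral_def by (intro integral_nonneg_AE AE_I2) simp
  then show ?thesis using tail_weight_diff[OF assms] by simp
qed

lemma hit_weight_antimono:
  assumes "0 \<le> r" "\<bar>a\<bar> \<le> \<bar>b\<bar>"
  shows "hit_weight p l b r \<le> hit_weight p l a r"
  unfolding hit_weight_def using assms
  by (intro mult_left_mono) (auto intro!: divide_right_mono simp: abs_le_square_iff)

lemma tail_weight_antimono_space:
  assumes "0 \<le> s" "a \<noteq> 0 \<or> 0 < s" "\<bar>a\<bar> \<le> \<bar>b\<bar>"
  shows "tail_weight p l s b \<le> tail_weight p l s a"
  unfolding tail_weight_def using assms
  by (intro set_integral_mono integrable_tail hit_weight_antimono) auto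

lemma tail_weight_pos:
  assumes "0 \<le> s" "a \<noteq> 0 \<or> 0 < s"
  shows "0 < tail_weight p l s a"
proof (rule ccontr)
  assume "\<not> 0 < tail_weight p l s a"
  then have "(\<integral>\<^sup>+r. ennreal (hit_weight p l a r) * indicator {s<..} r \<partial>lborel) = 0"
    using ennreal_tail_weight[OF assms] tail_weight_nonneg[of s a] by simp
  then have "AE r in lborel. ennreal (hit_weight p l a r) * indicator {s<..} r = 0"
    by (subst (asm) nn_integral_0_iff_AE) auto
  then have "AE r in lborel. r \<notin> {s<..<s + 1}"
  proof eventually_elim
    case (elim r)
    then show ?case using assms(1) by (auto simp: hit_weight_def split: split_indicator_asm)
  qed
  then have "emeasure lborel {s<..<s + 1} = 0"
    by (subst (asm) AE_iff_measurable[where N="{s<..<s + 1}"]) auto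
  then show False by simp
qed

lemma survival_bounds:
  assumes "0 \<le> s"
  shows "0 \<le> survival p l s a" "survival p l s a \<le> 1"
  using tail_weight_pos[of 0 a] tail_weight_nonneg[of s a] tail_weight_antimono[of 0 s a] assms
  by (auto simp: survival_def divide_le_eq)

lemma survival_zero: "a \<noteq> 0 \<Longrightarrow> survival p l 0 a = 1"
  using tail_weight_pos[of 0 a] by (simp add: survival_def)

lemma survival_antimono:
  assumes "0 \<le> s" "s \<le> t"
  shows "survival p l t a \<le> survival p l s a"
  using tail_weight_pos[of 0 a] tail_weight_antimono[of s t a] assms
  by (auto simp: survival_def divide_right_mono)

lemma tail_weight_measurable [measurable]:
  assumes [measurable]: "f \<in> borel_measurable M"
  shows "(\<lambda>x. tail_weight p l s (f x)) \<in> borel_measurable M"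
proof -
  have "(\<lambda>a. tail_weight p l s a) \<in> borel_measurable borel"
    unfolding tail_weight_def set_lebesgue_integral_def by measurable
  from measurable_compose[OF assms this] show ?thesis by simp
qed

lemma survival_measurable [measurable]:
  assumes [measurable]: "f \<in> borel_measurable M"
  shows "(\<lambda>x. survival p l s (f x)) \<in> borel_measurable M"
  unfolding survival_def by measurable

text \<open>Numerator and denominator of the defect both vanish as \<open>a\<close> grows, so
  uniformity needs a comparison with the point \<open>e\<close>. The ratio of the weights at
  \<open>a\<close> and \<open>e\<close> is increasing in \<open>r\<close> and equals
  \<open>c\<close> at \<open>r = \<delta>\<close>: it is at most \<open>c\<close> on the numerator's
  range and at least \<open>c\<close> beyond it. Hence \<open>c\<close> cancels in the
  quotient.\<close>

lemma survival_defect_quadratic: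
  assumes e: "0 < e"
  obtains K where "0 \<le> K"
    "\<And>\<delta> a. 0 < \<delta> \<Longrightarrow> \<delta> \<le> 1 \<Longrightarrow> e \<le> a \<Longrightarrow> 1 - survival p l \<delta> a \<le> K * \<delta>\<^sup>2"
proof
  \<comment> \<open>Since \<open>\<delta> \<le> 1\<close>, the tail from time 1 at \<open>e\<close>
    is a lower bound for the denominator, up to the factor \<open>c\<close>, that does not depend on
    \<open>\<delta>\<close>.\<close>
  let ?K = "216 / e ^ 6 / tail_weight p l 1 e"
  have T1: "0 < tail_weight p l 1 e" by (rule tail_weight_pos) auto
  show "0 \<le> ?K" using T1 e by simp
  fix \<delta> a :: real assume \<delta>: "0 < \<delta>" "\<delta> \<le> 1" and a: "e \<le> a"
  define c where "c = exp (- (a\<^sup>2 - e\<^sup>2) / (2 * \<delta>))"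
  have c: "0 < c" by (simp add: c_def)
  have split: "hit_weight p l a r = exp (- (a\<^sup>2 - e\<^sup>2) / (2 * r)) * hit_weight p l e r" for r
    by (simp add: hit_weight_def mult_exp_exp diff_divide_distrib algebra_simps)
  have sq: "0 \<le> a\<^sup>2 - e\<^sup>2" using a e by (simp add: power_mono)
  have T0: "0 < tail_weight p l 0 a" "a \<noteq> 0" using a e by (auto intro!: tail_weight_pos)
  have "tail_weight p l 0 a - tail_weight p l \<delta> a = (LBINT r:{0<..\<delta>}. hit_weight p l a r)"
    using \<delta> T0 by (intro tail_weight_diff) auto
  also have "\<dots> \<le> (LBINT r:{0<..\<delta>}. c * (216 / e ^ 6 * \<delta>))"
  proof (rule set_integral_mono)
    show "set_integrable lborel {0<..\<delta>} (hit_weight p l a)"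
      using T0 by (intro integrable_tail_subset[of 0]) auto
    show "set_integrable lborel {0<..\<delta>} (\<lambda>r. c * (216 / e ^ 6 * \<delta>))"
      unfolding set_integrable_def using \<delta>
      by (intro integrable_scaleR_left integrable_real_indicator) auto
    fix r assume r: "r \<in> {0<..\<delta>}"
    have "(a\<^sup>2 - e\<^sup>2) / (2 * \<delta>) \<le> (a\<^sup>2 - e\<^sup>2) / (2 * r)"
      using r \<delta> sq by (intro divide_left_mono) auto
    then have "exp (- (a\<^sup>2 - e\<^sup>2) / (2 * r)) \<le> c"
      by (simp only: c_def exp_le_cancel_iff minus_divide_left[symmetric] neg_le_iff_le)
    moreover have "hit_weight p l e r \<le> 216 / e ^ 6 * \<delta>"
      using hit_weight_le_small[of p l r e] p l e r \<delta>
      by (intro order.trans[OF hit_weight_le_small]) (auto intro!: mult_left_mono divide_right_mono)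
    ultimately show "hit_weight p l a r \<le> c * (216 / e ^ 6 * \<delta>)"
      unfolding split by (intro mult_mono) (use c in auto)
  qed
  also have "\<dots> = c * (216 / e ^ 6) * \<delta>\<^sup>2"
    using \<delta> by (simp add: set_lebesgue_integral_def power2_eq_square)
  finally have num: "tail_weight p l 0 a - tail_weight p l \<delta> a \<le> c * (216 / e ^ 6) * \<delta>\<^sup>2" .
  have "c * tail_weight p l 1 e \<le> c * tail_weight p l \<delta> e"
    using c \<delta> by (intro mult_left_mono tail_weight_antimono) auto
  also have "\<dots> = (LBINT r:{\<delta><..}. c * hit_weight p l e r)"
    by (simp add: tail_weight_def)
  also have "\<dots> \<le> (LBINT r:{\<delta><..}. hit_weight p l a r)"
  proof (rule set_integral_mono)
    show "set_integrable lborel {\<delta><..} (\<lambda>r. c * hit_weight p l e r)"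
      using \<delta> by (intro set_integrable_mult_right integrable_tail) auto
    show "set_integrable lborel {\<delta><..} (hit_weight p l a)"
      using \<delta> by (intro integrable_tail) auto
    fix r assume r: "r \<in> {\<delta><..}"
    have "(a\<^sup>2 - e\<^sup>2) / (2 * r) \<le> (a\<^sup>2 - e\<^sup>2) / (2 * \<delta>)"
      using r \<delta> sq by (intro divide_left_mono) auto
    then have "c \<le> exp (- (a\<^sup>2 - e\<^sup>2) / (2 * r))"
      by (simp only: c_def exp_le_cancel_iff minus_divide_left[symmetric] neg_le_iff_le)
    then show "c * hit_weight p l e r \<le> hit_weight p l a r"
      unfolding split by (intro mult_right_mono) auto
  qed
  also have "\<dots> = tail_weight p l \<delta> a" by (simp add: tail_weight_def)
  also have "\<dots> \<le> tail_weight p l 0 a" using \<delta> T0 by (intro tail_weight_antimono) auto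
  finally have den: "c * tail_weight p l 1 e \<le> tail_weight p l 0 a" .
  have "1 - survival p l \<delta> a = (tail_weight p l 0 a - tail_weight p l \<delta> a) / tail_weight p l 0 a"
    using T0 by (simp add: survival_def diff_divide_distrib)
  also have "\<dots> \<le> (c * (216 / e ^ 6) * \<delta>\<^sup>2) / (c * tail_weight p l 1 e)"
    using num den T0 T1 c e by (intro frac_le) auto
  also have "\<dots> = ?K * \<delta>\<^sup>2"
    using c by simp
  finally show "1 - survival p l \<delta> a \<le> ?K * \<delta>\<^sup>2" .
qed

text \<open>The case \<open>p = 1\<close> diverges only logarithmically, so the radius is
  exponentially small. On \<open>{e\<^sup>2..1}\<close> the exponential factor is at least
  \<open>exp (- l - 1)\<close> and \<open>r powr (- p)\<close> at least \<open>1 / r\<close>, whose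
  integral is \<open>2 * (N + 1)\<close>; the factor \<open>exp (l + 1)\<close> in \<open>N\<close>
  compensates for the former.\<close>

lemma tail_weight_unbounded:
  obtains e where "0 < e" "M \<le> tail_weight p l 0 e"
proof -
  define N where "N = max M 0 * exp (l + 1)"
  define e where "e = exp (- (N + 1))"
  have N: "0 \<le> N" by (simp add: N_def)
  have e: "0 < e" "e < 1" "e\<^sup>2 \<le> 1" using N by (auto simp: e_def power_le_one)
  have e2: "e\<^sup>2 \<le> 1" "0 < e\<^sup>2" using e by auto
  have pos: "0 < r" if "e\<^sup>2 \<le> r" for r using that e2(2) by linarith
  have "ennreal (exp (- l - 1) * (2 * (N + 1))) = ennreal (exp (- l - 1)) * ennreal (ln 1 - ln (e\<^sup>2))"
    using e by (simp add: e_def ln_realpow ennreal_mult'' add.commute)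
  also have "ennreal (ln 1 - ln (e\<^sup>2)) = (\<integral>\<^sup>+r. ennreal (inverse r) * indicator {e\<^sup>2..1} r \<partial>lborel)"
    using e2 pos by (subst nn_integral_FTC_Icc[where F=ln and f=inverse])
      (auto intro!: DERIV_ln less_imp_le[of 0])
  also have "ennreal (exp (- l - 1)) * \<dots> = (\<integral>\<^sup>+r. ennreal (exp (- l - 1)) * (ennreal (inverse r) * indicator {e\<^sup>2..1} r) \<partial>lborel)"
    by (subst nn_integral_cmult) auto
  also have "\<dots> \<le> (\<integral>\<^sup>+r. ennreal (hit_weight p l e r) * indicator {0<..} r \<partial>lborel)"
  proof (intro nn_integral_mono)
    fix r :: real
    have "exp (- l - 1) * inverse r \<le> hit_weight p l e r" if r: "e\<^sup>2 \<le> r" "r \<le> 1"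
    proof -
      have r0: "0 < r" using r pos by simp
      have "e\<^sup>2 / (2 * r) \<le> 1" using r r0 by (simp add: divide_le_eq)
      moreover have "l * r \<le> l" using l r by simp
      ultimately have "exp (- l - 1) \<le> exp (- l * r - e\<^sup>2 / (2 * r))" by simp
      moreover have "inverse r \<le> r powr (- p)"
        using powr_mono'[of "-p" "-1" r] r r0 p by (simp add: powr_minus)
      ultimately have "inverse r * exp (- l - 1) \<le> hit_weight p l e r"
        unfolding hit_weight_def using r0 by (intro mult_mono) auto
      then show ?thesis by (simp only: mult.commute)
    qed
    with pos[of r] show "ennreal (exp (- l - 1)) * (ennreal (inverse r) * indicator {e\<^sup>2..1} r)
        \<le> ennreal (hit_weight p l e r) * indicator {0<..} r"
      by (auto simp: ennreal_mult'[symmetric] split: split_indicator)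
  qed
  also have "\<dots> = ennreal (tail_weight p l 0 e)"
    using e by (subst ennreal_tail_weight) auto
  finally have "exp (- l - 1) * (2 * (N + 1)) \<le> tail_weight p l 0 e"
    by (subst (asm) ennreal_le_iff) (rule tail_weight_nonneg)
  moreover have "M \<le> exp (- l - 1) * N"
    by (simp add: N_def mult_exp_exp mult.left_commute)
  moreover have "exp (- l - 1) * N \<le> exp (- l - 1) * (2 * (N + 1))"
    using N by (intro mult_left_mono) auto
  ultimately show thesis using that[OF e(1)] by linarith
qed

text \<open>For times at least \<open>s\<close> the numerator is bounded by its finite value at time
  \<open>s\<close> and the origin, while the denominator blows up.\<close>

lemma survival_small_near_origin:
  assumes s: "0 < s" and \<eta>: "0 < \<eta>"
  obtains e where "0 < e"
    "\<And>r a. s \<le> r \<Longrightarrow> 0 \<le> a \<Longrightarrow> a \<le> e \<Longrightarrow> survival p l r a \<le> \<eta>"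
proof -
  have Ts: "0 < tail_weight p l s 0" using s by (intro tail_weight_pos) auto
  obtain e where e: "0 < e" "tail_weight p l s 0 / \<eta> \<le> tail_weight p l 0 e"
    by (rule tail_weight_unbounded)
  show thesis
  proof (rule that[OF e(1)])
    fix r a :: real assume r: "s \<le> r" and a: "0 \<le> a" "a \<le> e"
    show "survival p l r a \<le> \<eta>"
    proof (cases "a = 0")
      case True
      then show ?thesis using \<eta> by (simp add: survival_def)
    next
      case False
      have "tail_weight p l r a \<le> tail_weight p l s a"
        using r s by (intro tail_weight_antimono) auto
      also have "\<dots> \<le> tail_weight p l s 0"
        using s by (intro tail_weight_antimono_space) auto
      also have "\<dots> \<le> \<eta> * tail_weight p l 0 e"
        using e \<eta> by (simp add: divide_le_eq mult.commute)
      also have "\<dots> \<le> \<eta> * tail_weight p l 0 a"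
        using a False \<eta> by (intro mult_left_mono tail_weight_antimono_space) auto
      finally show ?thesis
        using False tail_weight_pos[of 0 a] by (simp add: survival_def divide_le_eq)
    qed
  qed
qed

end

section \<open>Closed form in dimension three and the link to Bessel functions\<close>

lemma std_normal_primitive:
  obtains \<Phi> :: "real \<Rightarrow> real" where
    "\<And>z. (\<Phi> has_real_derivative std_normal_density z) (at z)"
    "(\<Phi> \<longlongrightarrow> 0) at_bot" "(\<Phi> \<longlongrightarrow> 1) at_top"
proof -
  \<comment> \<open>A distribution function has its limits at both ends by general theory, so only
    the derivative remains to be computed.\<close>
  define N where "N = density lborel (\<lambda>x. ennreal (std_normal_density x))"
  interpret N: real_distribution N
    unfolding N_def using real_dist_normal_dist by simp
  have cont: "continuous_on A std_normal_density" for A :: "real set"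
    unfolding std_normal_density_def by (intro continuous_intros) auto
  have incr: "cdf N y = cdf N a + integral {a..y} std_normal_density" if "a < y" for a y
  proof -
    have int: "set_integrable lborel {a..y} std_normal_density"
      by (intro borel_integrable_atLeastAtMost' cont)
    have "cdf N y - cdf N a = measure N {a<..y}"
      using that by (intro N.cdf_diff_eq)
    also have "\<dots> = measure N {a..y}"
    proof -
      have "emeasure N {a} = 0" by (simp add: N_def emeasure_density nn_integral_indicator_singleton')
      then have "measure N {a} = 0" by (simp add: measure_def)
      moreover have "{a..y} = {a<..y} \<union> {a}" using that by auto
      ultimately show ?thesis
        using N.finite_measure_Union[of "{a<..y}" "{a}"] by simp
    qed
    also have "\<dots> = integral {a..y} std_normal_density"
    proof -
      have "emeasure N {a..y} = (\<integral>\<^sup>+x. ennreal (std_normal_density x) * indicator {a..y} x \<partial>lborel)"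
        by (simp add: N_def emeasure_density)
      also have "\<dots> = ennreal (LINT x:{a..y}|lborel. std_normal_density x)"
        using int unfolding set_lebesgue_integral_def set_integrable_def
        by (subst nn_integral_eq_integral[symmetric])
           (auto intro!: nn_integral_cong split: split_indicator)
      also have "(LINT x:{a..y}|lborel. std_normal_density x) = integral {a..y} std_normal_density"
        using int by (rule set_borel_integral_eq_integral)
      finally show ?thesis
        by (simp add: measure_def integral_nonneg set_borel_integral_eq_integral(1)[OF int])
    qed
    finally show ?thesis by simp
  qed
  show thesis
  proof (rule that[of "cdf N"])
    fix z :: real
    have "((\<lambda>y. integral {z - 1..y} std_normal_density) has_real_derivative std_normal_density z)
        (at z within {z - 1..z + 1})"
      by (intro integral_has_real_derivative cont) auto
    then have "((\<lambda>y. integral {z - 1..y} std_normal_density) has_real_derivative std_normal_density z) (at z)"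
      by (simp add: at_within_Icc_at)
    then have *: "((\<lambda>y. cdf N (z - 1) + integral {z - 1..y} std_normal_density)
        has_real_derivative std_normal_density z) (at z)"
      by (auto intro!: derivative_eq_intros)
    show "(cdf N has_real_derivative std_normal_density z) (at z)"
      by (rule has_field_derivative_transform_within_open[OF *, of "{z - 1<..}"])
         (auto simp: incr[symmetric])
  next
    show "(cdf N \<longlongrightarrow> 0) at_bot" by (rule N.cdf_lim_at_bot)
    show "(cdf N \<longlongrightarrow> 1) at_top" by (rule N.cdf_lim_at_top_prob)
  qed
qed

text \<open>The primitive used here is the distribution function of the inverse Gaussian law.\<close>

lemma tail_weight_three_halves:
  assumes g: "0 < g" and a: "0 < a"
  shows "tail_weight (3 / 2) (g\<^sup>2 / 2) 0 a = sqrt (2 * pi) / a * exp (- g * a)"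
proof -
  obtain \<Phi> where \<Phi>: "\<And>z. (\<Phi> has_real_derivative std_normal_density z) (at z)"
    "(\<Phi> \<longlongrightarrow> 0) at_bot" "(\<Phi> \<longlongrightarrow> 1) at_top"
    using std_normal_primitive by blast
  define z1 z2 where "z1 r = g * sqrt r - a / sqrt r" and "z2 r = - g * sqrt r - a / sqrt r" for r
  define F where "F r = \<Phi> (z1 r) + exp (2 * g * a) * \<Phi> (z2 r)" for r
  \<comment> \<open>Normalises \<open>?f\<close> to the density of the first time at which Brownian
    motion with drift \<open>g\<close> reaches the level \<open>a\<close>; the integral of
    \<open>?f\<close> is therefore 1.\<close>
  define C where "C = a * exp (g * a) / sqrt (2 * pi)"
  let ?f = "\<lambda>r. C * hit_weight (3 / 2) (g\<^sup>2 / 2) a r"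
  have C: "0 < C" using a by (simp add: C_def)
  have deriv: "(F has_real_derivative ?f r) (at r)" if r: "0 < r" for r
  proof -
    have sr: "0 < sqrt r" "sqrt r * sqrt r = r" using r by auto
    have d1: "(z1 has_real_derivative (g / (2 * sqrt r) + a / (2 * r * sqrt r))) (at r)"
      unfolding z1_def[abs_def] using r
      by (auto intro!: derivative_eq_intros simp: field_simps)
    have d2: "(z2 has_real_derivative (- g / (2 * sqrt r) + a / (2 * r * sqrt r))) (at r)"
      unfolding z2_def[abs_def] using r
      by (auto intro!: derivative_eq_intros simp: field_simps)
    have sq1: "(z1 r)\<^sup>2 = g\<^sup>2 * r - 2 * g * a + a\<^sup>2 / r"
      using r by (simp add: z1_def power2_diff power_mult_distrib power_divide)
    have sq2: "(z2 r)\<^sup>2 = g\<^sup>2 * r + 2 * g * a + a\<^sup>2 / r"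
      using r by (simp add: z2_def power2_diff power_mult_distrib power_divide)
    \<comment> \<open>The squares of \<open>z1 r\<close> and \<open>z2 r\<close> differ by
      \<open>4 * g * a\<close>, which the weight in \<open>F\<close> offsets. In the derivative of
      \<open>F\<close> the terms with \<open>g\<close> then cancel and those with \<open>a\<close>
      double.\<close>
    have e: "exp (2 * g * a) * std_normal_density (z2 r) = std_normal_density (z1 r)"
      unfolding std_normal_density_def sq1 sq2
      by (simp add: mult_exp_exp field_simps)
    have "(F has_real_derivative
        std_normal_density (z1 r) * (g / (2 * sqrt r) + a / (2 * r * sqrt r)) +
        exp (2 * g * a) * (std_normal_density (z2 r) * (- g / (2 * sqrt r) + a / (2 * r * sqrt r)))) (at r)"
      unfolding F_def[abs_def]
      by (intro DERIV_add DERIV_cmult DERIV_chain2[OF \<Phi>(1)] d1 d2)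
    also have "exp (2 * g * a) * (std_normal_density (z2 r) * (- g / (2 * sqrt r) + a / (2 * r * sqrt r)))
        = std_normal_density (z1 r) * (- g / (2 * sqrt r) + a / (2 * r * sqrt r))"
      by (simp only: mult.assoc[symmetric] e)
    also have "std_normal_density (z1 r) * (g / (2 * sqrt r) + a / (2 * r * sqrt r)) + \<dots>
        = std_normal_density (z1 r) * (a / (r * sqrt r))"
      by (simp add: ring_distribs)
    also have "\<dots> = ?f r"
    proof -
      have "r powr (- (3 / 2)) = 1 / (r * sqrt r)"
        using r powr_add[of r 1 "1 / 2"] by (simp add: powr_minus_divide powr_half_sqrt)
      moreover have "exp (- (z1 r)\<^sup>2 / 2) = exp (g * a) * exp (- (g\<^sup>2 / 2) * r - a\<^sup>2 / (2 * r))"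
        unfolding sq1 by (simp add: mult_exp_exp field_simps)
      ultimately show ?thesis
        by (simp add: hit_weight_def std_normal_density_def C_def)
    qed
    finally show ?thesis .
  qed
  have lim0: "((F \<circ> real_of_ereal) \<longlongrightarrow> 0) (at_right 0)"
  proof -
    have s0: "(sqrt \<longlongrightarrow> 0) (at_right 0)"
      using tendsto_real_sqrt[OF tendsto_ident_at, of 0 "{0<..}"] by simp
    then have "filterlim sqrt (at_right 0) (at_right 0)"
      by (auto simp: filterlim_at eventually_at_filter)
    from filterlim_compose[OF filterlim_inverse_at_top_right this]
    have inv: "filterlim (\<lambda>r. a * inverse (sqrt r)) at_top (at_right 0)"
      by (intro filterlim_tendsto_pos_mult_at_top[OF tendsto_const a])
    have *: "filterlim (\<lambda>r. - (c * sqrt r) + a * inverse (sqrt r)) at_top (at_right 0)" for c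
      by (rule filterlim_tendsto_add_at_top[OF tendsto_minus[OF tendsto_mult[OF tendsto_const s0]] inv])
    have "filterlim z1 at_bot (at_right 0)" "filterlim z2 at_bot (at_right 0)"
      using *[of g] *[of "- g"] unfolding filterlim_uminus_at_bot z1_def[abs_def] z2_def[abs_def]
      by (simp_all add: divide_inverse algebra_simps)
    then have "(F \<longlongrightarrow> 0 + exp (2 * g * a) * 0) (at_right 0)"
      unfolding F_def[abs_def]
      by (intro tendsto_intros filterlim_compose[OF \<Phi>(2)])
    then show ?thesis
      by (simp add: zero_ereal_def ereal_tendsto_simps)
  qed
  have lim1: "((F \<circ> real_of_ereal) \<longlongrightarrow> 1) (at_left \<infinity>)"
  proof -
    have inv: "((\<lambda>r. inverse (sqrt r)) \<longlongrightarrow> 0) at_top"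
      by (rule tendsto_inverse_0_at_top[OF sqrt_at_top])
    have "filterlim (\<lambda>r. g * sqrt r) at_top at_top"
      by (rule filterlim_tendsto_pos_mult_at_top[OF tendsto_const g sqrt_at_top])
    then have *: "filterlim (\<lambda>r. c * inverse (sqrt r) + g * sqrt r) at_top at_top" for c
      by (rule filterlim_tendsto_add_at_top[OF tendsto_mult[OF tendsto_const inv]])
    have "filterlim z1 at_top at_top" "filterlim z2 at_bot at_top"
      using *[of "- a"] *[of a] unfolding filterlim_uminus_at_bot z1_def[abs_def] z2_def[abs_def]
      by (simp_all add: divide_inverse algebra_simps)
    then have "(F \<longlongrightarrow> 1 + exp (2 * g * a) * 0) at_top"
      unfolding F_def[abs_def]
      by (intro tendsto_intros filterlim_compose[OF \<Phi>(2)] filterlim_compose[OF \<Phi>(3)])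
    then show ?thesis
      by (simp add: ereal_tendsto_simps)
  qed
  have "(LBINT r=0..\<infinity>. ?f r) = 1 - 0"
  proof (rule interval_integral_FTC_nonneg(2)[where F = F])
    show "isCont ?f r" if "0 < ereal r" "ereal r < \<infinity>" for r
      unfolding hit_weight_def using that by (intro continuous_intros) auto
    show "AE r in lborel. 0 < ereal r \<longrightarrow> ereal r < \<infinity> \<longrightarrow> 0 \<le> ?f r"
      using C by (intro AE_I2) simp
  qed (use deriv lim0 lim1 in auto)
  then have "C * tail_weight (3 / 2) (g\<^sup>2 / 2) 0 a = 1"
    by (simp add: interval_lebesgue_integral_0_infty tail_weight_def)
  then show ?thesis
    using C a by (simp add: C_def exp_minus field_simps)
qed

text \<open>The substitution is \<open>u = l * r\<close>: with argument
  \<open>sqrt (2 * l) * a\<close> the term \<open>z\<^sup>2 / (4 * u)\<close> becomes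
  \<open>a\<^sup>2 / (2 * r)\<close>, and the cut-off \<open>l * s\<close> becomes the time
  \<open>s\<close>.\<close>

lemma inc_bessel_K_eq_tail_weight:
  assumes l: "0 < l" and a: "0 < a" and s: "0 \<le> s"
  shows "inc_bessel_K (p - 1) (sqrt (2 * l) * a) (l * s) =
    1 / 2 * (a / sqrt (2 * l)) powr (p - 1) * tail_weight p l s a"
proof -
  have "(LBINT u:{l * s<..}. u powr (- (p - 1) - 1) * exp (- u - (sqrt (2 * l) * a)\<^sup>2 / (4 * u)))
      = l * (LBINT r. indicator {l * s<..} (l * r) *
          ((l * r) powr (- p) * exp (- (l * r) - (2 * l * a\<^sup>2) / (4 * (l * r)))))"
    unfolding set_lebesgue_integral_def
    using l by (subst lborel_integral_real_affine[where c=l and t=0]) (auto simp: power_mult_distrib)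
  also have "(LBINT r. indicator {l * s<..} (l * r) *
          ((l * r) powr (- p) * exp (- (l * r) - (2 * l * a\<^sup>2) / (4 * (l * r))))) =
      (LBINT r. l powr (- p) * (indicator {s<..} r * hit_weight p l a r))"
  proof (intro Bochner_Integration.integral_cong refl)
    fix r :: real
    have "2 * l * a\<^sup>2 / (4 * (l * r)) = a\<^sup>2 / (2 * r)" using l by simp
    then show "indicator {l * s<..} (l * r) *
          ((l * r) powr (- p) * exp (- (l * r) - 2 * l * a\<^sup>2 / (4 * (l * r)))) =
        l powr (- p) * (indicator {s<..} r * hit_weight p l a r)"
      using l s by (auto simp: hit_weight_def powr_mult split: split_indicator)
  qed
  also have "l * \<dots> = l powr (- (p - 1)) * tail_weight p l s a"
  proof -
    have "l powr (- (p - 1)) = l * l powr (- p)"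
      using l powr_add[of l 1 "- p"] by simp
    moreover have "(LBINT r. l powr (- p) * (indicator {s<..} r * hit_weight p l a r)) =
        l powr (- p) * tail_weight p l s a"
      by (simp add: tail_weight_def set_lebesgue_integral_def)
    ultimately show ?thesis by (simp only: mult.assoc)
  qed
  finally have "inc_bessel_K (p - 1) (sqrt (2 * l) * a) (l * s) =
      1 / 2 * ((sqrt (2 * l) * a / 2) powr (p - 1) * l powr (- (p - 1))) * tail_weight p l s a"
    by (simp add: inc_bessel_K_def)
  also have "(sqrt (2 * l) * a / 2) powr (p - 1) * l powr (- (p - 1)) = (sqrt (2 * l) * a / 2 / l) powr (p - 1)"
    unfolding powr_minus_divide using l a by (subst powr_divide[of _ l]) auto
  also have "sqrt (2 * l) * a / 2 / l = a / sqrt (2 * l)"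
  proof -
    have "sqrt (2 * l) / (2 * l) = 1 / sqrt (2 * l)"
      using real_div_sqrt[of "2 * l"] l
      by (metis divide_divide_eq_right inverse_divide inverse_eq_divide less_imp_le mult_pos_pos zero_less_numeral)
    moreover have "sqrt (2 * l) * a / 2 / l = a * (sqrt (2 * l) / (2 * l))"
      by simp
    ultimately show ?thesis by simp
  qed
  finally show ?thesis .
qed

text \<open>In dimension two this unfolds the Bessel function of order 0; in dimension three the
  elementary ground state is recognised through \<open>tail_weight_three_halves\<close>. Only the
  existence of a constant independent of \<open>y\<close> matters, since it cancels in the ratio of
  ground states.\<close>

lemma ground_state_eq_tail_weight:
  assumes dim: "DIM('a::euclidean_space) \<in> {2, 3}" and g: "0 < g"
  obtains C where "0 < C"
    "\<And>y :: 'a. y \<noteq> 0 \<Longrightarrow> ground_state g y = C * tail_weight (DIM('a) / 2) (ground_energy DIM('a) g) 0 (norm y)"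
proof (cases "DIM('a) = 2")
  case True
  show thesis
  proof (rule that[of "sqrt (2 * g / pi) / 2"])
    show "ground_state g y = sqrt (2 * g / pi) / 2 *
        tail_weight (DIM('a) / 2) (ground_energy DIM('a) g) 0 (norm y)" if "y \<noteq> 0" for y :: 'a
      using that True g inc_bessel_K_eq_tail_weight[of g "norm y" 0 1]
      by (simp add: ground_state_def ground_energy_def bessel_K_def)
  qed (use g in simp)
next
  case False
  then have d: "DIM('a) = 3" using dim by simp
  show thesis
  proof (rule that[of "sqrt (g / (2 * pi)) / sqrt (2 * pi)"])
    show "ground_state g y = sqrt (g / (2 * pi)) / sqrt (2 * pi) *
        tail_weight (DIM('a) / 2) (ground_energy DIM('a) g) 0 (norm y)" if "y \<noteq> 0" for y :: 'a
      using that d g tail_weight_three_halves[of g "norm y"]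
      by (simp add: ground_state_def ground_energy_def)
  qed (use g in simp)
qed

section \<open>Path space\<close>

lemma path_continuous:
  assumes "\<omega> \<in> mspace (path_metric T)"
  shows "continuous_on {0..T} \<omega>"
  using assms by (simp add: path_metric_def)

lemma space_path_borel [simp]: "space (path_borel T) = mspace (path_metric T)"
  by (simp add: path_borel_def space_measure_of_conv)

lemma space_path_filtration [simp]: "space (path_filtration T s) = mspace (path_metric T)"
  by (simp add: path_filtration_def space_measure_of_conv)

text \<open>Evaluation at a fixed time is 1-Lipschitz for the supremum metric, hence
  continuous.\<close>

lemma evaluation_measurable:
  assumes s: "s \<in> {0..T}"
  shows "(\<lambda>\<omega>. \<omega> s :: 'a::euclidean_space) \<in> borel_measurable (path_borel T)"
proof (rule borel_measurableI)
  fix U :: "'a set" assume U: "open U"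
  have "Lipschitz_continuous_map (path_metric T) euclidean_metric (\<lambda>\<omega>. \<omega> s :: 'a)"
    unfolding Lipschitz_continuous_map_def
  proof (intro conjI exI[of _ 1] ballI)
    fix \<omega> \<omega>' :: "real \<Rightarrow> 'a"
    assume "\<omega> \<in> mspace (path_metric T)" "\<omega>' \<in> mspace (path_metric T)"
    then have "mdist euclidean_metric (\<omega> s) (\<omega>' s) \<le> mdist (path_metric T) \<omega> \<omega>'"
      using s unfolding path_metric_def by (intro mdist_cfunspace_imp_mdist_le[OF _ _ order_refl]) auto
    then show "mdist euclidean_metric (\<omega> s) (\<omega>' s) \<le> 1 * mdist (path_metric T) \<omega> \<omega>'" by simp
  qed auto
  then have "continuous_map (mtopology_of (path_metric T)) euclidean (\<lambda>\<omega>. \<omega> s :: 'a)"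
    using Lipschitz_continuous_imp_continuous_map by fastforce
  then have "openin (mtopology_of (path_metric T)) {\<omega> \<in> mspace (path_metric T). \<omega> s \<in> U}"
    using openin_continuous_map_preimage[where Y = euclidean and U = U] U by (simp flip: topspace_mtopology_of)
  then have "{\<omega> \<in> mspace (path_metric T). \<omega> s \<in> U} \<in> sets (path_borel T)"
    unfolding path_borel_def
    by (subst sets_measure_of) (auto dest: openin_subset[THEN subsetD])
  moreover have "(\<lambda>\<omega>. \<omega> s) -` U \<inter> space (path_borel T) = {\<omega> \<in> mspace (path_metric T). \<omega> s \<in> U}"
    by auto
  ultimately show "(\<lambda>\<omega>. \<omega> s) -` U \<inter> space (path_borel T) \<in> sets (path_borel T)"
    by simp
qed

lemma evaluation_measurable_filtration:
  assumes "0 \<le> r" "r \<le> s"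
  shows "(\<lambda>\<omega>. \<omega> r :: 'a::euclidean_space) \<in> borel_measurable (path_filtration T s)"
proof (rule measurableI)
  fix B :: "'a set" assume "B \<in> sets borel"
  then have "{\<omega> \<in> mspace (path_metric T). \<omega> r \<in> B} \<in> sets (path_filtration T s)"
    using assms unfolding path_filtration_def
    by (subst sets_measure_of) (auto intro!: sigma_sets.Basic)
  moreover have "(\<lambda>\<omega>. \<omega> r) -` B \<inter> space (path_filtration T s) = {\<omega> \<in> mspace (path_metric T). \<omega> r \<in> B}"
    by auto
  ultimately show "(\<lambda>\<omega>. \<omega> r) -` B \<inter> space (path_filtration T s) \<in> sets (path_filtration T s)"
    by simp
qed auto

lemma subalgebra_path_filtration:
  assumes "s \<le> T"
  shows "subalgebra (path_borel T) (path_filtration T s :: (real \<Rightarrow> 'a::euclidean_space) measure)"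
proof -
  have "{\<omega> \<in> mspace (path_metric T). \<omega> r \<in> B} \<in> sets (path_borel T)"
    if "0 \<le> r" "r \<le> s" "B \<in> sets borel" for r and B :: "'a set"
  proof -
    have "(\<lambda>\<omega>. \<omega> r) -` B \<inter> space (path_borel T) \<in> sets (path_borel T)"
      using that assms by (intro measurable_sets[OF evaluation_measurable]) auto
    also have "(\<lambda>\<omega>. \<omega> r) -` B \<inter> space (path_borel T) = {\<omega> \<in> mspace (path_metric T). \<omega> r \<in> B}"
      by auto
    finally show ?thesis .
  qed
  then have "sets (path_filtration T s :: (real \<Rightarrow> 'a) measure) \<subseteq> sets (path_borel T)"
    unfolding path_filtration_def
    by (subst sets_measure_of, force)
       (intro sets.sigma_sets_subset[of _ "path_borel T", unfolded space_path_borel], auto)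
  then show ?thesis by (simp add: subalgebra_def)
qed

text \<open>The zero set of a continuous path is compact, so a finite infimum is attained. This is
  why \<open>ereal t < hitting_time T \<omega>\<close> excludes a zero at time \<open>t\<close>
  itself.\<close>

lemma hitting_time_cases:
  assumes \<omega>: "continuous_on {0..T} \<omega>"
  obtains "\<And>s. s \<in> {0..T} \<Longrightarrow> \<omega> s \<noteq> (0 :: 'a::euclidean_space)" "hitting_time T \<omega> = \<infinity>"
  | m where "m \<in> {0..T}" "\<omega> m = 0" "\<And>s. 0 \<le> s \<Longrightarrow> s < m \<Longrightarrow> \<omega> s \<noteq> 0" "hitting_time T \<omega> = ereal m"
proof -
  let ?Z = "{t \<in> {0..T}. \<omega> t = 0}"
  show thesis
  proof (cases "?Z = {}")
    case True
    have "hitting_time T \<omega> = \<infinity>"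
      unfolding hitting_time_def True by (simp add: top_ereal_def)
    then show ?thesis using that(1) True by blast
  next
    case False
    have "closed ?Z"
      using continuous_closed_preimage[OF \<omega> closed_atLeastAtMost closed_singleton[of 0]]
      by (simp add: vimage_def Int_def conj_commute)
    moreover have "?Z \<subseteq> {0..T}" by auto
    from bounded_subset[OF bounded_closed_interval this] have "bounded ?Z" .
    ultimately have "compact ?Z" by (simp only: compact_eq_bounded_closed)
    from compact_attains_inf[OF this False]
    obtain m where m: "m \<in> ?Z" "\<And>s. s \<in> ?Z \<Longrightarrow> m \<le> s" by blast
    have "hitting_time T \<omega> = ereal m"
      unfolding hitting_time_def
    proof (rule antisym)
      show "Inf (ereal ` ?Z) \<le> ereal m" using m(1) by (intro Inf_lower) auto
      show "ereal m \<le> Inf (ereal ` ?Z)" using m(2) by (intro Inf_greatest) auto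
    qed
    moreover have "\<omega> s \<noteq> 0" if "0 \<le> s" "s < m" for s
      using m(2)[of s] m(1) that by fastforce
    ultimately show ?thesis using that(2)[of m] m(1) by blast
  qed
qed

lemma hitting_time_greater_iff:
  assumes \<omega>: "continuous_on {0..T} \<omega>" and t: "t \<in> {0..T}"
  shows "ereal t < hitting_time T \<omega> \<longleftrightarrow> (\<forall>s\<in>{0..t}. \<omega> s \<noteq> (0 :: 'a::euclidean_space))"
  using hitting_time_cases[OF \<omega>]
proof cases
  case 1
  then show ?thesis using t by auto
next
  case (2 m)
  show ?thesis
  proof
    assume "ereal t < hitting_time T \<omega>"
    then show "\<forall>s\<in>{0..t}. \<omega> s \<noteq> 0" using 2 by auto
  next
    assume "\<forall>s\<in>{0..t}. \<omega> s \<noteq> 0"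
    then have "t < m" using 2(1,2) by force
    then show "ereal t < hitting_time T \<omega>" using 2(4) by simp
  qed
qed

section \<open>The killed semigroup\<close>

text \<open>\<open>ground_density\<close> without the interaction term, the ratio of ground states
  being written as a ratio of tail integrals. It is sub-Markovian: by
  \<open>killed_semigroup_one\<close> its mass is the survival quotient.\<close>

definition killed_density :: "nat \<Rightarrow> real \<Rightarrow> real \<Rightarrow> 'a::euclidean_space \<Rightarrow> 'a \<Rightarrow> real" where
  "killed_density d l t y z =
     exp (- l * t) * (tail_weight (d / 2) l 0 (norm z) / tail_weight (d / 2) l 0 (norm y)) * free_heat t (y - z)"

locale ground_state_setting =
  fixes \<gamma> l :: real and x :: "'a::euclidean_space"
  assumes dim: "DIM('a) \<in> {2, 3}" and \<gamma>: "0 < \<gamma>" and x: "x \<noteq> 0"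
    and l_eq: "l = ground_energy DIM('a) \<gamma>"
begin

sublocale weight_params "real DIM('a) / 2" l
  using dim \<gamma> by unfold_locales (auto simp: ground_energy_def l_eq)

abbreviation W :: "real \<Rightarrow> 'a \<Rightarrow> real" where
  "W s z \<equiv> tail_weight (real DIM('a) / 2) l s (norm z)"

abbreviation u :: "real \<Rightarrow> 'a \<Rightarrow> real" where
  "u s z \<equiv> survival (real DIM('a) / 2) l s (norm z)"

abbreviation k :: "real \<Rightarrow> 'a \<Rightarrow> 'a \<Rightarrow> real" where
  "k \<equiv> killed_density DIM('a) l"

lemma k_nonneg [simp]: "0 \<le> k t y z"
  by (simp add: killed_density_def tail_weight_nonneg)

lemma k_measurable [measurable]:
  assumes [measurable]: "f \<in> borel_measurable M" "g \<in> borel_measurable M"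
  shows "(\<lambda>x. k t (f x) (g x)) \<in> borel_measurable M"
  unfolding killed_density_def by measurable

lemma hit_weight_eq_free_heat:
  assumes "0 < r"
  shows "hit_weight (real DIM('a) / 2) l (norm (z :: 'a)) r =
    (2 * pi) powr (real DIM('a) / 2) * exp (- l * r) * free_heat r z"
proof -
  let ?q = "real DIM('a) / 2"
  have "(2 * pi) powr ?q * (2 * pi * r) powr (- ?q) = ((2 * pi) powr ?q * (2 * pi) powr (- ?q)) * r powr (- ?q)"
    by (simp only: powr_mult mult.assoc)
  also have "(2 * pi) powr ?q * (2 * pi) powr (- ?q) = 1"
    by (simp only: powr_add[symmetric]) simp
  finally have c: "(2 * pi) powr ?q * (2 * pi * r) powr (- ?q) = r powr (- ?q)" by simp
  have "(2 * pi) powr ?q * exp (- l * r) * free_heat r z =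
      ((2 * pi) powr ?q * (2 * pi * r) powr (- ?q)) * (exp (- l * r) * exp (- (norm z)\<^sup>2 / (2 * r)))"
    by (simp add: free_heat_def)
  then show ?thesis
    unfolding c mult_exp_exp hit_weight_def by simp
qed

text \<open>\<open>W s\<close> is a mixture of heat kernels over times \<open>r > s\<close>.
  Convolution with \<open>free_heat t\<close> shifts each time by \<open>t\<close>, so the cut-off
  moves to \<open>s + t\<close>; rewriting \<open>exp (- l * r)\<close> at the shifted time produces
  \<open>exp (l * t)\<close>.\<close>

lemma nn_integral_free_heat_W:
  assumes t: "0 < t" and s: "0 \<le> s" and y: "y \<noteq> 0"
  shows "(\<integral>\<^sup>+z. ennreal (free_heat t (y - z) * W s z) \<partial>lborel) = ennreal (exp (l * t) * W (s + t) y)"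
proof -
  let ?c = "(2 * pi) powr (real DIM('a) / 2)"
  let ?h = "hit_weight (real DIM('a) / 2) l"
  have "(\<integral>\<^sup>+z. ennreal (free_heat t (y - z) * W s z) \<partial>lborel) =
      (\<integral>\<^sup>+z. (\<integral>\<^sup>+r. ennreal (free_heat t (y - z)) * (ennreal (?h (norm z) r) * indicator {s<..} r) \<partial>lborel) \<partial>(lborel :: 'a measure))"
  \<comment> \<open>For \<open>s = 0\<close> the integral defining \<open>W s z\<close> diverges at
    \<open>z = 0\<close>, where its Bochner value is 0; this is a null set of
    \<open>z\<close>.\<close>
  proof (rule nn_integral_cong_AE, use AE_lborel_singleton[of "0::'a"] in eventually_elim)
    case (elim z)
    then show ?case
      using s by (simp add: ennreal_mult tail_weight_nonneg ennreal_tail_weight nn_integral_cmult)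
  qed
  also have "\<dots> = (\<integral>\<^sup>+r. (\<integral>\<^sup>+z. ennreal (free_heat t (y - z)) * (ennreal (?h (norm z) r) * indicator {s<..} r) \<partial>(lborel :: 'a measure)) \<partial>lborel)"
    by (rule lborel_pair.Fubini'[symmetric]) measurable
  also have "\<dots> = (\<integral>\<^sup>+r. ennreal (exp (l * t) * ?h (norm y) (t + r)) * indicator {s<..} r \<partial>lborel)"
  proof (rule nn_integral_cong)
    fix r :: real
    show "(\<integral>\<^sup>+z. ennreal (free_heat t (y - z)) * (ennreal (?h (norm z) r) * indicator {s<..} r) \<partial>(lborel :: 'a measure)) =
      ennreal (exp (l * t) * ?h (norm y) (t + r)) * indicator {s<..} r"
    proof (cases "s < r")
      case True
      then have r: "0 < r" using s by simp
      have "(\<integral>\<^sup>+z. ennreal (free_heat t (y - z)) * (ennreal (?h (norm z) r) * indicator {s<..} r) \<partial>(lborel :: 'a measure)) =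
        (\<integral>\<^sup>+z. ennreal (?c * exp (- l * r)) * ennreal (free_heat t (y - z) * free_heat r z) \<partial>(lborel :: 'a measure))"
        using True r by (intro nn_integral_cong)
          (simp add: hit_weight_eq_free_heat ennreal_mult'[symmetric] mult_ac)
      also have "\<dots> = ennreal (?c * exp (- l * r)) * ennreal (free_heat (t + r) y)"
        using free_heat_convolution[OF t r, of y] by (simp add: nn_integral_cmult)
      also have "\<dots> = ennreal (exp (l * t) * ?h (norm y) (t + r))"
        using r t by (simp add: hit_weight_eq_free_heat ennreal_mult'[symmetric] mult_exp_exp algebra_simps)
      finally show ?thesis using True by simp
    qed simp
  qed
  also have "\<dots> = ennreal (exp (l * t)) * (\<integral>\<^sup>+r. ennreal (?h (norm y) (t + 1 * r)) * indicator {s + t<..} (t + 1 * r) \<partial>lborel)"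
    by (subst nn_integral_cmult[symmetric])
       (auto simp: ennreal_mult' mult.assoc intro!: nn_integral_cong split: split_indicator)
  also have "(\<integral>\<^sup>+r. ennreal (?h (norm y) (t + 1 * r)) * indicator {s + t<..} (t + 1 * r) \<partial>lborel) =
      (\<integral>\<^sup>+r. ennreal (?h (norm y) r) * indicator {s + t<..} r \<partial>lborel)"
    using nn_integral_real_affine[of "\<lambda>r. ennreal (?h (norm y) r) * indicator {s + t<..} r" 1 t]
    by simp
  also have "\<dots> = ennreal (W (s + t) y)"
    using s t by (subst ennreal_tail_weight) auto
  finally show ?thesis by (simp add: ennreal_mult')
qed

lemma killed_semigroup_u:
  assumes t: "0 < t" and s: "0 \<le> s" and y: "y \<noteq> 0"
  shows "(\<integral>\<^sup>+z. ennreal (k t y z) * ennreal (u s z) \<partial>lborel) = ennreal (u (s + t) y)"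
proof -
  have Wy: "0 < W 0 y" using y by (intro tail_weight_pos) auto
  let ?c = "exp (- l * t) / W 0 y"
  have "(\<integral>\<^sup>+z. ennreal (k t y z) * ennreal (u s z) \<partial>lborel) =
      (\<integral>\<^sup>+z. ennreal ?c * ennreal (free_heat t (y - z) * W s z) \<partial>lborel)"
  proof (rule nn_integral_cong_AE, use AE_lborel_singleton[of "0::'a"] in eventually_elim)
    case (elim z)
    then have "0 < W 0 z" by (intro tail_weight_pos) auto
    then have "k t y z * u s z = ?c * (free_heat t (y - z) * W s z)"
      using elim by (simp add: killed_density_def survival_def)
    moreover have "0 \<le> ?c" using Wy by simp
    ultimately show ?case
      by (simp only: ennreal_mult'[symmetric] k_nonneg)
  qed
  also have "\<dots> = ennreal ?c * ennreal (exp (l * t) * W (s + t) y)"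
    by (subst nn_integral_cmult) (simp_all add: nn_integral_free_heat_W[OF t s y])
  also have "\<dots> = ennreal (u (s + t) y)"
  proof -
    have "?c * (exp (l * t) * W (s + t) y) = exp (- l * t + l * t) * W (s + t) y / W 0 y"
      by (simp only: exp_add) simp
    also have "\<dots> = u (s + t) y" using y by (simp add: survival_def)
    finally have "?c * (exp (l * t) * W (s + t) y) = u (s + t) y" .
    moreover have "ennreal ?c * ennreal (exp (l * t) * W (s + t) y) = ennreal (?c * (exp (l * t) * W (s + t) y))"
      using Wy by (intro ennreal_mult'[symmetric]) auto
    ultimately show ?thesis by simp
  qed
  finally show ?thesis .
qed

lemma killed_semigroup_one:
  assumes t: "0 < t" and y: "y \<noteq> 0"
  shows "(\<integral>\<^sup>+z. ennreal (k t y z) \<partial>lborel) = ennreal (u t y)"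
proof -
  have "(\<integral>\<^sup>+z. ennreal (k t y z) \<partial>lborel) = (\<integral>\<^sup>+z. ennreal (k t y z) * ennreal (u 0 z) \<partial>lborel)"
    by (rule nn_integral_cong_AE, use AE_lborel_singleton[of "0::'a"] in eventually_elim)
       (simp add: survival_zero)
  then show ?thesis using killed_semigroup_u[OF t order_refl y] by simp
qed

text \<open>The complementary test function is needed because a lower bound on the transition kernel
  bounds an expectation from above only through its complement. Adding \<open>u (s + t) y\<close> to
  both sides avoids subtraction of extended reals.\<close>

lemma killed_semigroup_defect:
  assumes t: "0 < t" and s: "0 \<le> s" and y: "y \<noteq> 0"
  shows "(\<integral>\<^sup>+z. ennreal (k t y z) * ennreal (1 - u s z) \<partial>lborel) = ennreal (u t y - u (s + t) y)"
proof -
  have "(\<integral>\<^sup>+z. ennreal (k t y z) * ennreal (1 - u s z) \<partial>lborel) + ennreal (u (s + t) y) =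
      (\<integral>\<^sup>+z. ennreal (k t y z) * ennreal (1 - u s z) + ennreal (k t y z) * ennreal (u s z) \<partial>lborel)"
    unfolding killed_semigroup_u[OF assms, symmetric] by (rule nn_integral_add[symmetric]) measurable
  also have "\<dots> = (\<integral>\<^sup>+z. ennreal (k t y z) \<partial>lborel)"
    using survival_bounds[OF s]
    by (intro nn_integral_cong) (simp add: distrib_left[symmetric] ennreal_plus[symmetric] del: ennreal_plus)
  also have "\<dots> = ennreal (u t y - u (s + t) y) + ennreal (u (s + t) y)"
    using survival_antimono[of t "s + t" "norm y"] survival_bounds(1)[of "s + t" "norm y"] s t
    by (simp add: killed_semigroup_one[OF t y] ennreal_plus[symmetric] del: ennreal_plus)
  finally show ?thesis by (simp add: ennreal_add_left_cancel add.commute[of _ "ennreal (u (s + t) y)"])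
qed

end

section \<open>The hitting probability\<close>

lemma (in ground_state_setting) killed_density_le_ground_density:
  assumes t: "0 < t" and y: "y \<noteq> 0" and z: "z \<noteq> 0"
  shows "k t y (z :: 'a) \<le> ground_density \<gamma> t y z"
proof -
  obtain C where C: "0 < C" "\<And>y :: 'a. y \<noteq> 0 \<Longrightarrow> ground_state \<gamma> y = C * W 0 y"
    using ground_state_eq_tail_weight[OF dim \<gamma>] unfolding l_eq by blast
  have "0 \<le> exp (- l * t) * (W 0 z / W 0 y)"
    by (simp add: tail_weight_nonneg)
  then have "k t y z \<le> exp (- l * t) * (W 0 z / W 0 y) * point_kernel \<gamma> t y z"
    unfolding killed_density_def
    by (intro mult_left_mono free_heat_le_point_kernel \<gamma> t)
  also have "\<dots> = ground_density \<gamma> t y z"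
    using C y z by (simp add: ground_density_def l_eq)
  finally show ?thesis .
qed

section \<open>The Markov property and one-step estimates\<close>

locale ground_diffusion = ground_state_setting \<gamma> l x
  for \<gamma> l :: real and x :: "'a::euclidean_space" +
  fixes T :: real and P :: "(real \<Rightarrow> 'a) measure"
  assumes diffusion: "ground_state_diffusion T \<gamma> x P" and T: "0 < T"
begin

sublocale prob_space P
  using diffusion by (simp add: ground_state_diffusion_def)

lemma space_P: "space P = mspace (path_metric T)"
  and sets_P: "sets P = sets (path_borel T)"
  and AE_start: "AE \<omega> in P. \<omega> 0 = x"
  using diffusion by (simp_all add: ground_state_diffusion_def)

lemma markov:
  assumes "0 \<le> s" "s < t" "t \<le> T" "B \<in> sets borel"
  shows "AE \<omega> in P. real_cond_exp P (path_filtration T s) (\<lambda>\<omega>'. indicator B (\<omega>' t)) \<omega> =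
    (LBINT y:B. ground_density \<gamma> (t - s) (\<omega> s) y)"
  using diffusion assms by (simp add: ground_state_diffusion_def)

lemma eval_measurable: "s \<in> {0..T} \<Longrightarrow> (\<lambda>\<omega>. \<omega> s) \<in> borel_measurable P"
  using evaluation_measurable[of s T] measurable_cong_sets[OF sets_P refl, of borel] by blast

lemma subalgebra_P: "s \<le> T \<Longrightarrow> subalgebra P (path_filtration T s)"
  using subalgebra_path_filtration[of s T] by (simp add: subalgebra_def sets_P space_P)

text \<open>The Markov property with \<open>B = UNIV\<close>: the conditional expectation of the
  constant 1 is 1.\<close>

lemma conservative:
  assumes "0 \<le> s" "s < t" "t \<le> T"
  shows "AE \<omega> in P. (LBINT y. ground_density \<gamma> (t - s) (\<omega> s) y) = 1"
proof -
  interpret F: finite_measure_subalgebra P "path_filtration T s"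
    using subalgebra_P[of s] assms by unfold_locales auto
  have "AE \<omega> in P. real_cond_exp P (path_filtration T s) (\<lambda>_. 1) \<omega> = 1"
    by (rule F.real_cond_exp_F_meas) auto
  with markov[OF assms borel_open[OF open_UNIV]] show ?thesis
    by eventually_elim (simp add: set_lebesgue_integral_def)
qed

text \<open>The Markov property turns the probability into an integral of
  \<open>ground_density\<close> over \<open>A\<close>, which dominates \<open>k\<close> pointwise.
  Paths in \<open>A\<close> avoid the origin at time \<open>s\<close>, where neither kernel is
  meaningful.\<close>

lemma transition_dominates:
  assumes st: "0 \<le> s" "s < t" "t \<le> T" and A: "A \<in> sets (path_filtration T s)"
    and A0: "\<And>\<omega>. \<omega> \<in> A \<Longrightarrow> \<omega> s \<noteq> 0" and B: "B \<in> sets borel"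
  shows "(\<integral>\<^sup>+\<omega>. (\<integral>\<^sup>+z. ennreal (k (t - s) (\<omega> s) z) * indicator B z \<partial>lborel) * indicator A \<omega> \<partial>P)
    \<le> emeasure P {\<omega> \<in> A. \<omega> t \<in> B}"
proof -
  interpret F: finite_measure_subalgebra P "path_filtration T s"
    using subalgebra_P[of s] st by unfold_locales auto
  let ?E = "real_cond_exp P (path_filtration T s) (\<lambda>\<omega>'. indicator B (\<omega>' t))"
  have A_P [measurable]: "A \<in> sets P"
    using A subalgebra_P[of s] st by (auto simp: subalgebra_def)
  have [measurable]: "(\<lambda>\<omega>. \<omega> t) \<in> borel_measurable P" "B \<in> sets borel"
    using st B by (auto intro!: eval_measurable)
  have int: "integrable P (\<lambda>\<omega>. indicator B (\<omega> t) :: real)"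
    by (rule integrable_const_bound[where B=1]) auto
  have intE: "integrable P ?E" by (rule F.real_cond_exp_int) (fact int)
  have "AE \<omega> in P. (\<integral>\<^sup>+z. ennreal (k (t - s) (\<omega> s) z) * indicator B z \<partial>lborel) * indicator A \<omega>
      \<le> ennreal (indicator A \<omega> * ?E \<omega>) \<and> 0 \<le> indicator A \<omega> * ?E \<omega>"
    using conservative[OF st] markov[OF st B]
  proof eventually_elim
    case (elim \<omega>)
    show ?case
    proof (cases "\<omega> \<in> A")
      case True
      note y = A0[OF True]
      let ?q = "ground_density \<gamma> (t - s) (\<omega> s)"
      \<comment> \<open>A non-integrable density would have Bochner integral 0, so the value 1
        forces integrability.\<close>
      have q: "integrable lborel ?q"
        using elim(1) not_integrable_integral_eq by fastforce
      have le: "AE z in lborel. k (t - s) (\<omega> s) z \<le> ?q z"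
        using AE_lborel_singleton[of "0::'a"]
        by eventually_elim (use st y in \<open>simp add: killed_density_le_ground_density\<close>)
      then have q0: "AE z in lborel. 0 \<le> ?q z"
        by eventually_elim (meson k_nonneg order_trans)
      have "(\<integral>\<^sup>+z. ennreal (k (t - s) (\<omega> s) z) * indicator B z \<partial>lborel)
          \<le> (\<integral>\<^sup>+z. ennreal (indicator B z * ?q z) \<partial>lborel)"
        by (rule nn_integral_mono_AE, use le in eventually_elim) (auto intro: ennreal_leI split: split_indicator)
      also have "\<dots> = ennreal (LBINT z. indicator B z * ?q z)"
      proof (rule nn_integral_eq_integral)
        show "integrable lborel (\<lambda>z. indicator B z * ?q z)"
          using integrable_mult_indicator[OF _ q, of B] B by simp
        show "AE z in lborel. 0 \<le> indicator B z * ?q z"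
          using q0 by eventually_elim simp
      qed
      also have "(LBINT z. indicator B z * ?q z) = ?E \<omega>"
        using elim(2) by (simp add: set_lebesgue_integral_def)
      finally have 1: "(\<integral>\<^sup>+z. ennreal (k (t - s) (\<omega> s) z) * indicator B z \<partial>lborel) \<le> ennreal (?E \<omega>)" .
      have "0 \<le> (LBINT z. indicator B z * ?q z)"
        by (rule integral_nonneg_AE, use q0 in eventually_elim) simp
      then have "0 \<le> ?E \<omega>" using elim(2) by (simp add: set_lebesgue_integral_def)
      with 1 True show ?thesis by simp
    qed simp
  qed
  then have AE1: "AE \<omega> in P. (\<integral>\<^sup>+z. ennreal (k (t - s) (\<omega> s) z) * indicator B z \<partial>lborel) * indicator A \<omega>
      \<le> ennreal (indicator A \<omega> * ?E \<omega>)"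
    and AE2: "AE \<omega> in P. 0 \<le> indicator A \<omega> * ?E \<omega>"
    by (auto elim: eventually_mono)
  have "(\<integral>\<^sup>+\<omega>. (\<integral>\<^sup>+z. ennreal (k (t - s) (\<omega> s) z) * indicator B z \<partial>lborel) * indicator A \<omega> \<partial>P)
      \<le> (\<integral>\<^sup>+\<omega>. ennreal (indicator A \<omega> * ?E \<omega>) \<partial>P)"
    by (rule nn_integral_mono_AE[OF AE1])
  also have "\<dots> = ennreal (LINT \<omega>|P. indicator A \<omega> * ?E \<omega>)"
    using integrable_mult_indicator[OF A_P intE] by (intro nn_integral_eq_integral AE2) simp
  also have "(LINT \<omega>|P. indicator A \<omega> * ?E \<omega>) = (LINT \<omega>|P. indicator A \<omega> * indicator B (\<omega> t))"
    using F.real_cond_exp_intA[OF int A] by (simp add: set_lebesgue_integral_def)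
  also have "\<dots> = (LINT \<omega>|P. indicator {\<omega> \<in> A. \<omega> t \<in> B} \<omega>)"
    by (intro Bochner_Integration.integral_cong) (auto split: split_indicator)
  also have "\<dots> = measure P {\<omega> \<in> A. \<omega> t \<in> B}"
  proof -
    have "{\<omega> \<in> A. \<omega> t \<in> B} \<in> sets P"
    proof -
      have "{\<omega> \<in> A. \<omega> t \<in> B} = A \<inter> ((\<lambda>\<omega>. \<omega> t) -` B \<inter> space P)"
        using sets.sets_into_space[OF A_P] by auto
      then show ?thesis by simp
    qed
    then show ?thesis by simp
  qed
  finally show ?thesis by (simp add: emeasure_eq_measure)
qed

text \<open>Both sides integrate \<open>f\<close> against measures on the state space:
  \<open>M1\<close> is the law of the path at time \<open>t\<close> restricted to \<open>A\<close>,
  and \<open>M2\<close> has the averaged kernel as density. The inequality on Borel sets says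
  \<open>M2 \<le> M1\<close>, which passes to integrals.\<close>

lemma transition_dominates_nn_integral:
  assumes st: "0 \<le> s" "s < t" "t \<le> T" and A: "A \<in> sets (path_filtration T s)"
    and A0: "\<And>\<omega>. \<omega> \<in> A \<Longrightarrow> \<omega> s \<noteq> 0" and [measurable]: "f \<in> borel_measurable borel"
  shows "(\<integral>\<^sup>+\<omega>. (\<integral>\<^sup>+z. ennreal (k (t - s) (\<omega> s) z) * f z \<partial>lborel) * indicator A \<omega> \<partial>P)
    \<le> (\<integral>\<^sup>+\<omega>. f (\<omega> t) * indicator A \<omega> \<partial>P)"
proof -
  have [measurable]: "A \<in> sets P"
    using A subalgebra_P[of s] st by (auto simp: subalgebra_def)
  have [measurable]: "(\<lambda>\<omega>. \<omega> t) \<in> borel_measurable P" "(\<lambda>\<omega>. \<omega> s) \<in> borel_measurable P"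
    using st by (auto intro!: eval_measurable)
  interpret pair_sigma_finite "lborel :: 'a measure" P ..
  define M1 where "M1 = distr (density P (indicator A)) borel (\<lambda>\<omega>. \<omega> t)"
  define g where "g z = (\<integral>\<^sup>+\<omega>. ennreal (k (t - s) (\<omega> s) z) * indicator A \<omega> \<partial>P)" for z
  define M2 where "M2 = density lborel g"
  have g [measurable]: "g \<in> borel_measurable borel"
    unfolding g_def by measurable
  have M2: "(\<integral>\<^sup>+z. h z \<partial>M2) = (\<integral>\<^sup>+\<omega>. (\<integral>\<^sup>+z. ennreal (k (t - s) (\<omega> s) z) * h z \<partial>lborel) * indicator A \<omega> \<partial>P)"
    if [measurable]: "h \<in> borel_measurable borel" for h
  proof -
    have "(\<integral>\<^sup>+z. h z \<partial>M2) = (\<integral>\<^sup>+z. (\<integral>\<^sup>+\<omega>. ennreal (k (t - s) (\<omega> s) z) * indicator A \<omega> * h z \<partial>P) \<partial>lborel)"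
      unfolding M2_def g_def by (subst nn_integral_density) (simp_all add: nn_integral_multc)
    also have "\<dots> = (\<integral>\<^sup>+\<omega>. (\<integral>\<^sup>+z. ennreal (k (t - s) (\<omega> s) z) * indicator A \<omega> * h z \<partial>lborel) \<partial>P)"
      by (rule Fubini'[symmetric]) measurable
    also have "\<dots> = (\<integral>\<^sup>+\<omega>. (\<integral>\<^sup>+z. ennreal (k (t - s) (\<omega> s) z) * h z \<partial>lborel) * indicator A \<omega> \<partial>P)"
      by (intro nn_integral_cong) (auto split: split_indicator)
    finally show ?thesis .
  qed
  have M1: "(\<integral>\<^sup>+z. h z \<partial>M1) = (\<integral>\<^sup>+\<omega>. h (\<omega> t) * indicator A \<omega> \<partial>P)"
    if [measurable]: "h \<in> borel_measurable borel" for h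
    unfolding M1_def by (simp add: nn_integral_distr nn_integral_density mult.commute)
  have sets: "sets M2 = sets M1" by (simp add: M1_def M2_def)
  have "emeasure M2 B \<le> emeasure M1 B" for B
  proof (cases "B \<in> sets borel")
    case True
    then have [measurable]: "B \<in> sets borel" .
    have B1: "B \<in> sets M1" "B \<in> sets M2" using True by (auto simp: M1_def M2_def)
    have "emeasure M2 B = (\<integral>\<^sup>+\<omega>. (\<integral>\<^sup>+z. ennreal (k (t - s) (\<omega> s) z) * indicator B z \<partial>lborel) * indicator A \<omega> \<partial>P)"
      using M2[of "indicator B"] B1 by simp
    also have "\<dots> \<le> emeasure P {\<omega> \<in> A. \<omega> t \<in> B}"
      by (rule transition_dominates[where s = s and t = t and A = A and B = B, OF st A _ True]) (rule A0)
    also have "\<dots> = (\<integral>\<^sup>+\<omega>. indicator {\<omega> \<in> A. \<omega> t \<in> B} \<omega> \<partial>P)"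
    proof -
      have "{\<omega> \<in> A. \<omega> t \<in> B} = A \<inter> ((\<lambda>\<omega>. \<omega> t) -` B \<inter> space P)"
        using sets.sets_into_space[OF \<open>A \<in> sets P\<close>] by auto
      then show ?thesis by simp
    qed
    also have "\<dots> = (\<integral>\<^sup>+\<omega>. indicator B (\<omega> t) * indicator A \<omega> \<partial>P)"
      by (intro nn_integral_cong) (auto split: split_indicator)
    also have "\<dots> = emeasure M1 B"
      using M1[of "indicator B"] B1 by simp
    finally show ?thesis .
  qed (simp add: M1_def M2_def emeasure_notin_sets)
  then have "M2 \<le> M1"
    by (auto simp: le_measure_iff le_fun_def sets sets_eq_imp_space_eq[OF sets])
  from nn_integral_mono_measure[OF sets this, of f] show ?thesis
    by (simp add: M1 M2)
qed

lemma nn_integral_indicator_times: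
  assumes [measurable]: "A \<in> sets P" "g \<in> borel_measurable P" and g: "\<And>\<omega>. 0 \<le> g \<omega>" "\<And>\<omega>. g \<omega> \<le> (1::real)"
  shows "(\<integral>\<^sup>+\<omega>. ennreal (g \<omega>) * indicator A \<omega> \<partial>P) = ennreal (LINT \<omega>|P. indicator A \<omega> * g \<omega>)"
    and "integrable P (\<lambda>\<omega>. indicator A \<omega> * g \<omega>)"
proof -
  show int: "integrable P (\<lambda>\<omega>. indicator A \<omega> * g \<omega>)"
    by (rule integrable_const_bound[where B=1]) (use g in \<open>auto split: split_indicator\<close>)
  show "(\<integral>\<^sup>+\<omega>. ennreal (g \<omega>) * indicator A \<omega> \<partial>P) = ennreal (LINT \<omega>|P. indicator A \<omega> * g \<omega>)"
    by (subst nn_integral_eq_integral[OF int, symmetric])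
       (auto simp: g intro!: nn_integral_cong split: split_indicator)
qed

lemma u_measurable: "s \<in> {0..T} \<Longrightarrow> (\<lambda>\<omega>. u r (\<omega> s)) \<in> borel_measurable P"
  using eval_measurable[of s] by measurable

text \<open>Domination tested against \<open>u r\<close> gives the first estimate. Tested against
  \<open>1 - u r\<close> it bounds the integral of \<open>u (t - s) - u (r + (t - s))\<close> at
  time \<open>s\<close> by that of \<open>1 - u r\<close> at time \<open>t\<close>, which rearranges
  to the second.\<close>

lemma one_step:
  assumes st: "0 \<le> s" "s < t" "t \<le> T" and A: "A \<in> sets (path_filtration T s)"
    and A0: "\<And>\<omega>. \<omega> \<in> A \<Longrightarrow> \<omega> s \<noteq> 0" and r: "0 \<le> r"
  shows "(LINT \<omega>|P. indicator A \<omega> * u (r + (t - s)) (\<omega> s)) \<le> (LINT \<omega>|P. indicator A \<omega> * u r (\<omega> t))"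
    and "(LINT \<omega>|P. indicator A \<omega> * u r (\<omega> t)) \<le>
      (LINT \<omega>|P. indicator A \<omega> * u (r + (t - s)) (\<omega> s)) + (LINT \<omega>|P. indicator A \<omega> * (1 - u (t - s) (\<omega> s)))"
proof -
  let ?v = "\<lambda>\<omega>. u (r + (t - s)) (\<omega> s)" and ?w = "\<lambda>\<omega>. u (t - s) (\<omega> s)" and ?ur = "\<lambda>\<omega>. u r (\<omega> t)"
  have [measurable]: "A \<in> sets P"
    using A subalgebra_P[of s] st by (auto simp: subalgebra_def)
  have [measurable]: "?v \<in> borel_measurable P" "?w \<in> borel_measurable P" "?ur \<in> borel_measurable P"
    using st by (auto intro!: u_measurable)
  have bv: "0 \<le> ?v \<omega>" "?v \<omega> \<le> 1" and bw: "0 \<le> ?w \<omega>" "?w \<omega> \<le> 1" and bu: "0 \<le> ?ur \<omega>" "?ur \<omega> \<le> 1"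
    and vw: "?v \<omega> \<le> ?w \<omega>" for \<omega>
    using st r by (auto intro!: survival_bounds survival_antimono)
  have dom: "(\<integral>\<^sup>+\<omega>. ennreal (g \<omega>) * indicator A \<omega> \<partial>P) \<le> (\<integral>\<^sup>+\<omega>. ennreal (h (\<omega> t)) * indicator A \<omega> \<partial>P)"
    if h [measurable]: "h \<in> borel_measurable borel"
      and kh: "\<And>\<omega>. \<omega> s \<noteq> 0 \<Longrightarrow> (\<integral>\<^sup>+z. ennreal (k (t - s) (\<omega> s) z) * ennreal (h z) \<partial>lborel) = ennreal (g \<omega>)"
    for g and h
  proof -
    have "(\<integral>\<^sup>+\<omega>. ennreal (g \<omega>) * indicator A \<omega> \<partial>P) =
        (\<integral>\<^sup>+\<omega>. (\<integral>\<^sup>+z. ennreal (k (t - s) (\<omega> s) z) * ennreal (h z) \<partial>lborel) * indicator A \<omega> \<partial>P)"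
      using A0 by (intro nn_integral_cong) (auto simp: kh split: split_indicator)
    also have "\<dots> \<le> (\<integral>\<^sup>+\<omega>. ennreal (h (\<omega> t)) * indicator A \<omega> \<partial>P)"
      by (rule transition_dominates_nn_integral[where s = s and t = t and A = A and f = "\<lambda>z. ennreal (h z)", OF st A])
         (use A0 in auto)
    finally show ?thesis .
  qed
  have "ennreal (LINT \<omega>|P. indicator A \<omega> * ?v \<omega>) \<le> ennreal (LINT \<omega>|P. indicator A \<omega> * ?ur \<omega>)"
    using dom[of "u r" ?v] killed_semigroup_u[of "t - s" r] st r
    by (simp add: nn_integral_indicator_times(1) bv bu)
  moreover have "0 \<le> (LINT \<omega>|P. indicator A \<omega> * ?ur \<omega>)"
    by (intro integral_nonneg_AE AE_I2 mult_nonneg_nonneg bu) auto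
  ultimately show "(LINT \<omega>|P. indicator A \<omega> * ?v \<omega>) \<le> (LINT \<omega>|P. indicator A \<omega> * ?ur \<omega>)"
    by (simp add: ennreal_le_iff)
  have bd: "0 \<le> ?w \<omega> - ?v \<omega>" "?w \<omega> - ?v \<omega> \<le> 1" "0 \<le> 1 - ?ur \<omega>" "1 - ?ur \<omega> \<le> 1" for \<omega>
    using bv[of \<omega>] bw[of \<omega>] bu[of \<omega>] vw[of \<omega>] by linarith+
  have "ennreal (LINT \<omega>|P. indicator A \<omega> * (?w \<omega> - ?v \<omega>)) \<le> ennreal (LINT \<omega>|P. indicator A \<omega> * (1 - ?ur \<omega>))"
  proof -
    have "(\<integral>\<^sup>+\<omega>. ennreal (?w \<omega> - ?v \<omega>) * indicator A \<omega> \<partial>P) = ennreal (LINT \<omega>|P. indicator A \<omega> * (?w \<omega> - ?v \<omega>))"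
      "(\<integral>\<^sup>+\<omega>. ennreal (1 - ?ur \<omega>) * indicator A \<omega> \<partial>P) = ennreal (LINT \<omega>|P. indicator A \<omega> * (1 - ?ur \<omega>))"
      by (intro nn_integral_indicator_times(1) bd; measurable)+
    then show ?thesis
      using dom[of "\<lambda>z. 1 - u r z" "\<lambda>\<omega>. ?w \<omega> - ?v \<omega>"] killed_semigroup_defect[of "t - s" r] st r
      by simp
  qed
  moreover have "0 \<le> (LINT \<omega>|P. indicator A \<omega> * (1 - ?ur \<omega>))"
    by (intro integral_nonneg_AE AE_I2 mult_nonneg_nonneg bd) auto
  ultimately have le: "(LINT \<omega>|P. indicator A \<omega> * (?w \<omega> - ?v \<omega>)) \<le> (LINT \<omega>|P. indicator A \<omega> * (1 - ?ur \<omega>))"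
    by (simp add: ennreal_le_iff)
  have int: "integrable P (\<lambda>\<omega>. indicator A \<omega> * ?v \<omega>)" "integrable P (\<lambda>\<omega>. indicator A \<omega> * ?w \<omega>)"
     "integrable P (\<lambda>\<omega>. indicator A \<omega> * ?ur \<omega>)" "integrable P (\<lambda>\<omega>. indicator A \<omega> :: real)"
    by (simp_all add: nn_integral_indicator_times(2) bv bw bu emeasure_eq_measure)
  have "(LINT \<omega>|P. indicator A \<omega> * (?w \<omega> - ?v \<omega>)) = (LINT \<omega>|P. indicator A \<omega> * ?w \<omega>) - (LINT \<omega>|P. indicator A \<omega> * ?v \<omega>)"
    "(LINT \<omega>|P. indicator A \<omega> * (1 - ?ur \<omega>)) = (LINT \<omega>|P. indicator A \<omega>) - (LINT \<omega>|P. indicator A \<omega> * ?ur \<omega>)"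
    "(LINT \<omega>|P. indicator A \<omega> * (1 - ?w \<omega>)) = (LINT \<omega>|P. indicator A \<omega>) - (LINT \<omega>|P. indicator A \<omega> * ?w \<omega>)"
    by (simp_all only: right_diff_distrib mult_1_right Bochner_Integration.integral_diff int)
  with le show "(LINT \<omega>|P. indicator A \<omega> * ?ur \<omega>) \<le>
      (LINT \<omega>|P. indicator A \<omega> * ?v \<omega>) + (LINT \<omega>|P. indicator A \<omega> * (1 - ?w \<omega>))"
    by linarith
qed

section \<open>The discretised process stopped near the origin\<close>

definition grid_avoid :: "real \<Rightarrow> real \<Rightarrow> nat \<Rightarrow> nat \<Rightarrow> (real \<Rightarrow> 'a) set" where
  "grid_avoid e S n j = {\<omega> \<in> space P. \<forall>i\<le>j. e < norm (\<omega> (real i * S / real n))}"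

text \<open>The event inspects only grid times up to index \<open>j\<close> and is therefore known
  at time \<open>j * S / n\<close>, as required of the event in \<open>one_step\<close>.\<close>

lemma grid_avoid_sets:
  assumes "0 \<le> S"
  shows "grid_avoid e S n j \<in> sets (path_filtration T (real j * S / real n))" (is "_ \<in> sets ?F")
proof -
  have "(\<lambda>\<omega>. \<omega> (real i * S / real n)) -` {z :: 'a. e < norm z} \<inter> space ?F \<in> sets ?F" if "i \<le> j" for i
    using assms that
    by (intro measurable_sets[OF evaluation_measurable_filtration])
       (auto intro!: divide_right_mono mult_right_mono)
  then have "(\<Inter>i\<in>{..j}. (\<lambda>\<omega>. \<omega> (real i * S / real n)) -` {z :: 'a. e < norm z} \<inter> space ?F) \<in> sets ?F"
    by (intro sets.finite_INT) auto
  also have "(\<Inter>i\<in>{..j}. (\<lambda>\<omega>. \<omega> (real i * S / real n)) -` {z :: 'a. e < norm z} \<inter> space ?F) = grid_avoid e S n j"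
    by (auto simp: grid_avoid_def space_P)
  finally show ?thesis .
qed

lemma grid_time_bounds:
  assumes "0 \<le> S" "j \<le> n"
  shows "0 \<le> real j * S / real n" "real j * S / real n \<le> S"
proof -
  show "0 \<le> real j * S / real n" using assms by simp
  have "S * (real j / real n) \<le> S * 1"
    using assms by (intro mult_left_mono) (auto simp: divide_le_eq)
  then show "real j * S / real n \<le> S" by (simp add: mult.commute)
qed

lemma grid_avoid_sets_P:
  assumes "0 \<le> S" "S \<le> T" "j \<le> n"
  shows "grid_avoid e S n j \<in> sets P"
proof -
  have "real j * S / real n \<le> T" using grid_time_bounds[OF assms(1,3)] assms(2) by simp
  from subalgebra_P[OF this] grid_avoid_sets[OF assms(1)] show ?thesis
    by (auto simp: subalgebra_def)
qed

lemma grid_avoid_start: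
  assumes e: "e < norm x"
  shows "(LINT \<omega>|P. indicator (grid_avoid e S n 0) \<omega> * u t (\<omega> 0)) = u t x"
    and "measure P (grid_avoid e S n 0) = 1"
proof -
  have *: "AE \<omega> in P. \<omega> \<in> grid_avoid e S n 0"
    using AE_start AE_space by eventually_elim (use e in \<open>auto simp: grid_avoid_def\<close>)
  have [measurable]: "grid_avoid e S n 0 \<in> sets P"
  proof -
    have "(\<lambda>\<omega>. \<omega> 0) -` {z :: 'a. e < norm z} \<inter> space P \<in> sets P"
      using T by (intro measurable_sets[OF eval_measurable]) auto
    also have "(\<lambda>\<omega>. \<omega> 0) -` {z :: 'a. e < norm z} \<inter> space P = grid_avoid e S n 0"
      by (auto simp: grid_avoid_def)
    finally show ?thesis .
  qed
  show "measure P (grid_avoid e S n 0) = 1" using * by (subst prob_eq_1) auto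
  have [measurable]: "(\<lambda>\<omega>. u t (\<omega> 0)) \<in> borel_measurable P"
    using T by (intro u_measurable) auto
  have "(LINT \<omega>|P. indicator (grid_avoid e S n 0) \<omega> * u t (\<omega> 0)) = (LINT \<omega>|P. u t x)"
    by (rule integral_cong_AE) (use * AE_start in \<open>auto elim!: eventually_elim2\<close>)
  then show "(LINT \<omega>|P. indicator (grid_avoid e S n 0) \<omega> * u t (\<omega> 0)) = u t x"
    by (simp add: prob_space)
qed

text \<open>The event keeps the index \<open>j\<close> while time advances to
  \<open>\<tau> (Suc j)\<close>, because conditioning takes place at \<open>\<tau> j\<close>.
  Replacing it by the next event is left to \<open>grid_bounds\<close>.\<close>

lemma grid_step:
  fixes n j :: nat
  assumes S: "0 < S" "S \<le> t" "t \<le> T" and n: "Suc j \<le> n" and e: "0 < e"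
  defines "A \<equiv> grid_avoid e S n" and "\<tau> \<equiv> \<lambda>j. real j * S / real n"
  shows "(LINT \<omega>|P. indicator (A j) \<omega> * u (t - \<tau> j) (\<omega> (\<tau> j))) \<le>
      (LINT \<omega>|P. indicator (A j) \<omega> * u (t - \<tau> (Suc j)) (\<omega> (\<tau> (Suc j))))" (is ?lower)
    and "(LINT \<omega>|P. indicator (A j) \<omega> * u (t - \<tau> (Suc j)) (\<omega> (\<tau> (Suc j)))) \<le>
      (LINT \<omega>|P. indicator (A j) \<omega> * u (t - \<tau> j) (\<omega> (\<tau> j))) +
      (LINT \<omega>|P. indicator (A j) \<omega> * (1 - u (S / n) (\<omega> (\<tau> j))))" (is ?upper)
proof -
  have b: "0 \<le> \<tau> j" "\<tau> (Suc j) \<le> S" "\<tau> (Suc j) - \<tau> j = S / n"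
    using grid_time_bounds[of S j n] grid_time_bounds[of S "Suc j" n] S n
    by (auto simp: \<tau>_def ring_distribs add_divide_distrib)
  moreover have "0 < S / n" using S n by simp
  ultimately have lt: "\<tau> j < \<tau> (Suc j)" by linarith
  have eq: "t - \<tau> (Suc j) + S / n = t - \<tau> j" using b(3) by simp
  have A: "A j \<in> sets (path_filtration T (\<tau> j))"
    unfolding A_def \<tau>_def using S by (intro grid_avoid_sets) auto
  have A0: "\<omega> (\<tau> j) \<noteq> 0" if "\<omega> \<in> A j" for \<omega>
    using that e by (auto simp: A_def grid_avoid_def \<tau>_def)
  have bT: "\<tau> (Suc j) \<le> T" "0 \<le> t - \<tau> (Suc j)" using b S by linarith+
  note os = one_step[where s = "\<tau> j" and t = "\<tau> (Suc j)" and r = "t - \<tau> (Suc j)" and A = "A j",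
      OF b(1) lt bT(1) A _ bT(2), unfolded b(3) eq]
  show ?lower by (rule os(1)) (rule A0)
  show ?upper by (rule os(2)) (rule A0)
qed

text \<open>Shrinking the event from \<open>j\<close> to \<open>Suc j\<close> only decreases the
  expectation, so the upper bound pays just \<open>D\<close> per step. For the lower bound, the part
  lost at each step is at most \<open>\<eta>\<close> times the probability of entering the ball
  then; these entrance events are disjoint, so their probabilities add up to that of having entered
  by index \<open>j\<close>.\<close>

lemma grid_bounds:
  fixes n j :: nat
  assumes S: "0 < S" "S \<le> t" "t \<le> T" and n: "j \<le> n" "0 < n" and e: "0 < e" "e < norm x"
  defines "M \<equiv> \<lambda>j. (LINT \<omega>|P. indicator (grid_avoid e S n j) \<omega> * u (t - real j * S / real n) (\<omega> (real j * S / real n)))"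
  shows "\<lbrakk>\<And>a. e \<le> a \<Longrightarrow> 1 - survival (real DIM('a) / 2) l (S / n) a \<le> D\<rbrakk> \<Longrightarrow> M j \<le> u t x + real j * D"
    and "\<lbrakk>\<And>r a. t - S \<le> r \<Longrightarrow> 0 \<le> a \<Longrightarrow> a \<le> e \<Longrightarrow> survival (real DIM('a) / 2) l r a \<le> \<eta>\<rbrakk> \<Longrightarrow>
      u t x \<le> M j + \<eta> * (1 - measure P (grid_avoid e S n j))"
proof -
  let ?A = "grid_avoid e S n"
  define \<tau> where "\<tau> j = real j * S / real n" for j
  define N where "N j = (LINT \<omega>|P. indicator (?A j) \<omega> * u (t - \<tau> (Suc j)) (\<omega> (\<tau> (Suc j))))" for j
  have M_eq: "M j = (LINT \<omega>|P. indicator (?A j) \<omega> * u (t - \<tau> j) (\<omega> (\<tau> j)))" for j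
    by (simp add: M_def \<tau>_def)
  have M0: "M 0 = u t x"
    using grid_avoid_start(1)[OF e(2), of S n t] by (simp add: M_def)
  have sub: "?A (Suc j) \<subseteq> ?A j" for j by (auto simp: grid_avoid_def)
  have Asets: "?A j \<in> sets P" if "j \<le> n" for j
    using grid_avoid_sets_P[of S j n] S that by auto
  have \<tau>: "0 \<le> \<tau> j" "\<tau> j \<le> S" "\<tau> j \<in> {0..T}" "0 \<le> t - \<tau> j" "t - S \<le> t - \<tau> j" if "j \<le> n" for j
    using grid_time_bounds[of S j n] S that by (auto simp: \<tau>_def)
  have um: "(\<lambda>\<omega>. u r (\<omega> (\<tau> j))) \<in> borel_measurable P" if "j \<le> n" for j r
    using \<tau>[OF that] by (intro u_measurable)
  have int: "integrable P (\<lambda>\<omega>. indicator (?A i) \<omega> * u (t - \<tau> j) (\<omega> (\<tau> j)))" if "i \<le> n" "j \<le> n" for i j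
    using \<tau>[OF that(2)] by (intro nn_integral_indicator_times Asets um that survival_bounds)
  have MN: "M (Suc j) \<le> N j" if "Suc j \<le> n" for j
    unfolding M_eq N_def using that sub[of j] \<tau>[of "Suc j"]
    by (intro integral_mono int) (auto split: split_indicator intro: survival_bounds)
  show "M j \<le> u t x + real j * D" if D: "\<And>a. e \<le> a \<Longrightarrow> 1 - survival (real DIM('a) / 2) l (S / n) a \<le> D"
    using n(1)
  proof (induction j)
    case 0
    then show ?case by (simp add: M0)
  next
    case (Suc j)
    have D0: "0 \<le> D"
      using D[of e] survival_bounds(2)[of "S / n" e] S by simp
    have "N j \<le> M j + (LINT \<omega>|P. indicator (?A j) \<omega> * (1 - u (S / n) (\<omega> (\<tau> j))))"
      using grid_step(2)[OF S Suc.prems e(1)] unfolding M_eq N_def \<tau>_def .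
    \<comment> \<open>On \<open>?A j\<close> the path is outside the ball at time
      \<open>\<tau> j\<close>, which is where the bound \<open>D\<close> applies.\<close>
    also have "(LINT \<omega>|P. indicator (?A j) \<omega> * (1 - u (S / n) (\<omega> (\<tau> j)))) \<le> (LINT \<omega>|P. D)"
    proof (rule integral_mono)
      show "integrable P (\<lambda>\<omega>. indicator (?A j) \<omega> * (1 - u (S / n) (\<omega> (\<tau> j))))"
        using Suc.prems S by (intro nn_integral_indicator_times borel_measurable_diff um Asets)
          (auto simp: survival_bounds)
      show "indicator (?A j) \<omega> * (1 - u (S / n) (\<omega> (\<tau> j))) \<le> D" for \<omega>
        using D D0 by (auto simp: grid_avoid_def \<tau>_def split: split_indicator)
    qed simp
    finally show ?case
      using MN[OF Suc.prems] Suc.IH Suc.prems by (simp add: prob_space ring_distribs)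
  qed
  show "u t x \<le> M j + \<eta> * (1 - measure P (?A j))"
    if \<eta>: "\<And>r a. t - S \<le> r \<Longrightarrow> 0 \<le> a \<Longrightarrow> a \<le> e \<Longrightarrow> survival (real DIM('a) / 2) l r a \<le> \<eta>"
    using n(1)
  proof (induction j)
    case 0
    show ?case using grid_avoid_start(2)[OF e(2), of S n] by (simp add: M0)
  next
    case (Suc j)
    then have jn: "j \<le> n" "Suc j \<le> n" by auto
    have "M j \<le> N j"
      using grid_step(1)[OF S Suc.prems e(1)] unfolding M_eq N_def \<tau>_def .
    also have "N j \<le> (LINT \<omega>|P. indicator (?A (Suc j)) \<omega> * u (t - \<tau> (Suc j)) (\<omega> (\<tau> (Suc j))) +
        \<eta> * indicator (?A j - ?A (Suc j)) \<omega>)"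
      unfolding N_def
    proof (rule integral_mono)
      show "integrable P (\<lambda>\<omega>. indicator (?A j) \<omega> * u (t - \<tau> (Suc j)) (\<omega> (\<tau> (Suc j))))"
        by (rule int) fact+
      show "integrable P (\<lambda>\<omega>. indicator (?A (Suc j)) \<omega> * u (t - \<tau> (Suc j)) (\<omega> (\<tau> (Suc j))) +
          \<eta> * indicator (?A j - ?A (Suc j)) \<omega>)"
        using Asets jn by (intro Bochner_Integration.integrable_add int integrable_mult_right integrable_real_indicator)
          (auto simp: emeasure_eq_measure)
      fix \<omega>
      \<comment> \<open>A path dropping out at index \<open>Suc j\<close> is inside the ball at
        exactly that grid time, with at least \<open>t - S\<close> left.\<close>
      have "u (t - \<tau> (Suc j)) (\<omega> (\<tau> (Suc j))) \<le> \<eta>" if "\<omega> \<in> ?A j" "\<omega> \<notin> ?A (Suc j)"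
      proof -
        have "norm (\<omega> (\<tau> (Suc j))) \<le> e"
          using that by (auto simp: grid_avoid_def \<tau>_def not_less le_Suc_eq)
        then show ?thesis using \<tau>[OF jn(2)] by (intro \<eta>) auto
      qed
      then show "indicator (?A j) \<omega> * u (t - \<tau> (Suc j)) (\<omega> (\<tau> (Suc j))) \<le>
          indicator (?A (Suc j)) \<omega> * u (t - \<tau> (Suc j)) (\<omega> (\<tau> (Suc j))) + \<eta> * indicator (?A j - ?A (Suc j)) \<omega>"
        using sub[of j] by (auto split: split_indicator)
    qed
    also have "\<dots> = M (Suc j) + \<eta> * measure P (?A j - ?A (Suc j))"
      unfolding M_eq using Asets jn
      by (subst Bochner_Integration.integral_add)
         (auto intro!: int integrable_mult_right integrable_real_indicator simp: emeasure_eq_measure)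
    also have "measure P (?A j - ?A (Suc j)) = measure P (?A j) - measure P (?A (Suc j))"
      using Asets jn sub[of j] by (intro finite_measure_Diff) auto
    finally show ?case using Suc.IH jn by (simp add: algebra_simps)
  qed
qed

section \<open>From dyadic grids to continuous time\<close>

lemma path_continuous_P: "\<omega> \<in> space P \<Longrightarrow> continuous_on {0..T} \<omega>"
  by (rule path_continuous) (simp add: space_P)

text \<open>Dyadic grids are nested, so the avoidance events decrease and their probabilities
  converge to that of the intersection.\<close>

definition dyadic_avoid :: "real \<Rightarrow> real \<Rightarrow> (real \<Rightarrow> 'a) set" where
  "dyadic_avoid e S = (\<Inter>m. grid_avoid e S (2 ^ m) (2 ^ m))"

lemma dyadic_avoid_sets: "0 \<le> S \<Longrightarrow> S \<le> T \<Longrightarrow> dyadic_avoid e S \<in> sets P"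
  unfolding dyadic_avoid_def by (intro sets.countable_INT) (auto intro: grid_avoid_sets_P)

lemma decseq_grid_avoid: "decseq (\<lambda>m. grid_avoid e S (2 ^ m) (2 ^ m))"
proof (rule decseq_SucI, rule subsetI)
  fix m \<omega> assume *: "\<omega> \<in> grid_avoid e S (2 ^ Suc m) (2 ^ Suc m)"
  have "e < norm (\<omega> (real i * S / real (2 ^ m)))" if "i \<le> 2 ^ m" for i
  proof -
    have "2 * i \<le> 2 ^ Suc m" using that by simp
    with * have "e < norm (\<omega> (real (2 * i) * S / real (2 ^ Suc m)))"
      unfolding grid_avoid_def by blast
    then show ?thesis by simp
  qed
  with * show "\<omega> \<in> grid_avoid e S (2 ^ m) (2 ^ m)" by (auto simp: grid_avoid_def)
qed

lemma dyadic_avoid_norm_ge: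
  assumes \<omega>: "\<omega> \<in> dyadic_avoid e S" and S: "0 < S" "S \<le> T" and s: "s \<in> {0..S}"
  shows "e \<le> norm (\<omega> s)"
proof -
  \<comment> \<open>\<open>q m\<close> is the last point of the grid of mesh
    \<open>S / 2 ^ m\<close> not exceeding \<open>s\<close>. It converges to \<open>s\<close>, and
    in the limit the strict bound by \<open>e\<close> becomes a weak one.\<close>
  define i where "i m = nat \<lfloor>s / S * 2 ^ m\<rfloor>" for m :: nat
  define q where "q m = real (i m) * S / real (2 ^ m)" for m
  have sS: "0 \<le> s / S" "s / S \<le> 1" using s S by auto
  have i: "real (i m) \<le> s / S * 2 ^ m" "s / S * 2 ^ m < real (i m) + 1" for m
  proof -
    have "real (i m) = real_of_int \<lfloor>s / S * 2 ^ m\<rfloor>"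
      unfolding i_def using mult_nonneg_nonneg[OF sS(1), of "2 ^ m"] by (intro of_nat_nat) (simp only: zero_le_floor, simp)
    then show "real (i m) \<le> s / S * 2 ^ m" "s / S * 2 ^ m < real (i m) + 1" by linarith+
  qed
  have i2: "i m \<le> 2 ^ m" for m
  proof -
    have "real (i m) \<le> 1 * 2 ^ m"
      by (rule order_trans[OF i(1) mult_right_mono[OF sS(2)]]) simp
    then have "real (i m) \<le> real (2 ^ m)" by simp
    then show ?thesis by (simp only: of_nat_le_iff)
  qed
  have q: "q m \<le> s" "s - S / 2 ^ m \<le> q m" for m
  proof -
    have c: "0 \<le> S / 2 ^ m" using S by simp
    have s_eq: "s = (s / S * 2 ^ m) * (S / 2 ^ m)" using S by simp
    have q_eq: "q m = real (i m) * (S / 2 ^ m)" by (simp add: q_def)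
    show "q m \<le> s"
      unfolding q_eq by (subst s_eq) (rule mult_right_mono[OF i(1) c])
    have "s \<le> (real (i m) + 1) * (S / 2 ^ m)"
      by (subst s_eq) (rule mult_right_mono[OF less_imp_le[OF i(2)] c])
    then show "s - S / 2 ^ m \<le> q m"
      unfolding q_eq distrib_right by simp
  qed
  have q0: "0 \<le> q m" for m using S by (simp add: q_def)
  have "(\<lambda>m. S / 2 ^ m) \<longlonglongrightarrow> 0"
    using tendsto_mult[OF tendsto_const LIMSEQ_inverse_realpow_zero[of 2], of S] by (simp add: divide_inverse)
  then have "(\<lambda>m. s - S / 2 ^ m) \<longlonglongrightarrow> s"
    using tendsto_diff[OF tendsto_const, of "\<lambda>m. S / 2 ^ m" 0 sequentially s] by simp
  then have "q \<longlonglongrightarrow> s"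
    by (rule tendsto_sandwich[OF _ _ _ tendsto_const, rotated 2]) (use q in auto)
  moreover have "\<omega> \<in> space P" using \<omega> by (auto simp: dyadic_avoid_def grid_avoid_def)
  ultimately have "(\<lambda>m. \<omega> (q m)) \<longlonglongrightarrow> \<omega> s"
    using s S q q0 order_trans[OF q(1)]
    by (intro continuous_on_tendsto_compose[OF path_continuous_P]) (auto intro!: always_eventually)
  then have "(\<lambda>m. norm (\<omega> (q m))) \<longlonglongrightarrow> norm (\<omega> s)" by (rule tendsto_norm)
  moreover have "e \<le> norm (\<omega> (q m))" for m
    using \<omega> i2[of m] unfolding dyadic_avoid_def grid_avoid_def q_def by (auto intro: less_imp_le)
  ultimately show ?thesis by (intro LIMSEQ_le_const) auto
qed

definition no_hit :: "real \<Rightarrow> (real \<Rightarrow> 'a) set" where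
  "no_hit S = {\<omega> \<in> space P. \<forall>s\<in>{0..S}. \<omega> s \<noteq> 0}"

text \<open>A path without zeros on a compact interval stays at positive distance from the origin.
  The offset 2 keeps every radius below \<open>norm x\<close>, so that the path starts outside the
  ball.\<close>

lemma no_hit_eq:
  assumes S: "0 < S" "S \<le> T"
  shows "no_hit S = (\<Union>i. dyadic_avoid (norm x / (real i + 2)) S)"
proof (intro equalityI subsetI)
  fix \<omega> assume \<omega>: "\<omega> \<in> no_hit S"
  then have "continuous_on {0..S} (\<lambda>s. norm (\<omega> s))"
    using S by (intro continuous_on_norm continuous_on_subset[OF path_continuous_P]) (auto simp: no_hit_def)
  from continuous_attains_inf[OF compact_Icc _ this]
  obtain m where m: "m \<in> {0..S}" "\<And>s. s \<in> {0..S} \<Longrightarrow> norm (\<omega> m) \<le> norm (\<omega> s)"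
    using S by auto
  have pos: "0 < norm (\<omega> m)" using \<omega> m(1) by (auto simp: no_hit_def)
  obtain i :: nat where "norm x / norm (\<omega> m) < real i" using reals_Archimedean2 by blast
  then have "norm x < real i * norm (\<omega> m)" using pos by (simp add: divide_less_eq)
  then have "norm x < (real i + 2) * norm (\<omega> m)" unfolding distrib_right using pos by linarith
  then have "norm x / (real i + 2) < norm (\<omega> m)" by (simp add: divide_less_eq mult.commute)
  moreover have "norm (\<omega> m) \<le> norm (\<omega> (real j * S / real (2 ^ n)))" if "j \<le> 2 ^ n" for j n :: nat
    using grid_time_bounds[OF less_imp_le[OF S(1)] that] by (intro m(2)) (simp only: atLeastAtMost_iff)
  ultimately have "\<omega> \<in> dyadic_avoid (norm x / (real i + 2)) S"
    using \<omega> unfolding dyadic_avoid_def grid_avoid_def no_hit_def by (blast intro: less_le_trans)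
  then show "\<omega> \<in> (\<Union>i. dyadic_avoid (norm x / (real i + 2)) S)" by blast
next
  fix \<omega> assume "\<omega> \<in> (\<Union>i. dyadic_avoid (norm x / (real i + 2)) S)"
  then obtain i where i: "\<omega> \<in> dyadic_avoid (norm x / (real i + 2)) S" by blast
  have "0 < norm x / (real i + 2)" using x by simp
  then have "\<omega> s \<noteq> 0" if "s \<in> {0..S}" for s
    using dyadic_avoid_norm_ge[OF i S that] by auto
  moreover have "\<omega> \<in> space P" using i by (auto simp: dyadic_avoid_def grid_avoid_def)
  ultimately show "\<omega> \<in> no_hit S" by (simp add: no_hit_def)
qed

lemma no_hit_sets: "0 < S \<Longrightarrow> S \<le> T \<Longrightarrow> no_hit S \<in> sets P"
  by (auto simp: no_hit_eq intro!: dyadic_avoid_sets)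

text \<open>Taking \<open>S = t\<close> makes the final integrand \<open>u 0 = 1\<close>, so the
  expectation is the probability of avoidance. The \<open>2 ^ m\<close> steps cost
  \<open>K * (t / 2 ^ m)\<^sup>2\<close> each, in total \<open>K * t\<^sup>2 / 2 ^ m\<close>, which
  tends to 0.\<close>

lemma prob_dyadic_avoid_le:
  assumes t: "0 < t" "t \<le> T" and e: "0 < e" "e < norm x"
  shows "measure P (dyadic_avoid e t) \<le> u t x"
proof -
  obtain K where K: "0 \<le> K"
    "\<And>\<delta> a. 0 < \<delta> \<Longrightarrow> \<delta> \<le> 1 \<Longrightarrow> e \<le> a \<Longrightarrow> 1 - survival (real DIM('a) / 2) l \<delta> a \<le> K * \<delta>\<^sup>2"
    using survival_defect_quadratic[OF e(1)] by blast
  have lim: "(\<lambda>m. t / 2 ^ m) \<longlonglongrightarrow> 0"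
    using tendsto_mult[OF tendsto_const LIMSEQ_inverse_realpow_zero[of 2], of t] by (simp add: divide_inverse)
  have bound: "measure P (dyadic_avoid e t) \<le> u t x + K * t * (t / 2 ^ m)" if m: "t / 2 ^ m \<le> 1" for m
  proof -
    let ?A = "grid_avoid e t (2 ^ m) (2 ^ m)"
    have A: "?A \<in> sets P" using t by (intro grid_avoid_sets_P) auto
    have "measure P (dyadic_avoid e t) \<le> measure P ?A"
      by (rule finite_measure_mono[OF _ A]) (auto simp: dyadic_avoid_def)
    also have "\<dots> = (LINT \<omega>|P. indicator ?A \<omega>)" using A by simp
    also have "\<dots> = (LINT \<omega>|P. indicator ?A \<omega> * u (t - real (2 ^ m) * t / real (2 ^ m)) (\<omega> (real (2 ^ m) * t / real (2 ^ m))))"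
    proof (intro Bochner_Integration.integral_cong refl)
      fix \<omega>
      have "\<omega> t \<noteq> 0" if "\<omega> \<in> ?A"
      proof -
        have "e < norm (\<omega> (real (2 ^ m) * t / real (2 ^ m)))"
          using that unfolding grid_avoid_def by blast
        then show ?thesis using e by auto
      qed
      then show "indicator ?A \<omega> = indicator ?A \<omega> * u (t - real (2 ^ m) * t / real (2 ^ m)) (\<omega> (real (2 ^ m) * t / real (2 ^ m)))"
        by (auto simp: survival_zero split: split_indicator)
    qed
    also have "\<dots> \<le> u t x + real (2 ^ m) * (K * (t / real (2 ^ m))\<^sup>2)"
    proof (rule grid_bounds(1)[where S = t and t = t and n = "2 ^ m" and j = "2 ^ m" and e = e])
      show "1 - survival (real DIM('a) / 2) l (t / real (2 ^ m)) a \<le> K * (t / real (2 ^ m))\<^sup>2" if "e \<le> a" for a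
        using that t m by (intro K(2)) auto
    qed (use t e in auto)
    also have "real (2 ^ m) * (K * (t / real (2 ^ m))\<^sup>2) = K * t * (t / 2 ^ m)"
      by (simp add: power2_eq_square)
    finally show ?thesis .
  qed
  have "(\<lambda>m. u t x + K * t * (t / 2 ^ m)) \<longlonglongrightarrow> u t x + K * t * 0"
    by (intro tendsto_intros lim)
  moreover have "\<forall>\<^sub>F m in sequentially. t / 2 ^ m \<le> 1"
    using order_tendstoD(2)[OF lim, of 1] by (auto elim: eventually_mono)
  then have "\<forall>\<^sub>F m in sequentially. measure P (dyadic_avoid e t) \<le> u t x + K * t * (t / 2 ^ m)"
    by (rule eventually_mono) (rule bound)
  ultimately show ?thesis
    using tendsto_lowerbound[of _ _ sequentially] by force
qed

lemma prob_dyadic_avoid_ge: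
  assumes S: "0 < S" "S \<le> t" "t \<le> T" and e: "0 < e" "e < norm x" and \<eta>0: "0 \<le> \<eta>"
    and \<eta>: "\<And>r a. t - S \<le> r \<Longrightarrow> 0 \<le> a \<Longrightarrow> a \<le> e \<Longrightarrow> survival (real DIM('a) / 2) l r a \<le> \<eta>"
  shows "u t x - \<eta> \<le> measure P (dyadic_avoid e S)"
proof -
  let ?A = "\<lambda>m. grid_avoid e S (2 ^ m) (2 ^ m)"
  have A: "?A m \<in> sets P" for m using S by (intro grid_avoid_sets_P) auto
  have "u t x - \<eta> \<le> measure P (?A m)" for m
  proof -
    let ?\<tau> = "real (2 ^ m) * S / real (2 ^ m)"
    have "u t x \<le> (LINT \<omega>|P. indicator (?A m) \<omega> * u (t - ?\<tau>) (\<omega> ?\<tau>)) + \<eta> * (1 - measure P (?A m))"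
      using S e by (intro grid_bounds(2) \<eta>) auto
    also have "(LINT \<omega>|P. indicator (?A m) \<omega> * u (t - ?\<tau>) (\<omega> ?\<tau>)) \<le> (LINT \<omega>|P. indicator (?A m) \<omega>)"
    proof (rule integral_mono)
      show "integrable P (\<lambda>\<omega>. indicator (?A m) \<omega> * u (t - ?\<tau>) (\<omega> ?\<tau>))"
        using S by (intro nn_integral_indicator_times A u_measurable survival_bounds) auto
      show "integrable P (indicator (?A m) :: _ \<Rightarrow> real)"
        using A by (simp add: emeasure_eq_measure)
      show "indicator (?A m) \<omega> * u (t - ?\<tau>) (\<omega> ?\<tau>) \<le> indicator (?A m) \<omega>" for \<omega>
        using S by (auto split: split_indicator intro: survival_bounds)
    qed
    also have "(LINT \<omega>|P. indicator (?A m) \<omega>) = measure P (?A m)" using A by simp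
    also have "\<eta> * (1 - measure P (?A m)) \<le> \<eta> * 1"
      using \<eta>0 by (intro mult_left_mono) auto
    finally show ?thesis by simp
  qed
  moreover have "(\<lambda>m. measure P (?A m)) \<longlonglongrightarrow> measure P (dyadic_avoid e S)"
    unfolding dyadic_avoid_def using A by (intro finite_Lim_measure_decseq decseq_grid_avoid) auto
  ultimately show ?thesis by (intro LIMSEQ_le_const) auto
qed

lemma prob_no_hit_le:
  assumes t: "0 < t" "t \<le> T"
  shows "measure P (no_hit t) \<le> u t x"
proof -
  let ?e = "\<lambda>i. norm x / (real i + 2)"
  have "?e j \<le> ?e i" if "i \<le> j" for i j
    using that by (intro divide_left_mono) auto
  then have "grid_avoid (?e i) t n m \<subseteq> grid_avoid (?e j) t n m" if "i \<le> j" for i j n m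
    using that unfolding grid_avoid_def by (auto intro: le_less_trans)
  then have "incseq (\<lambda>i. dyadic_avoid (?e i) t)"
    unfolding incseq_def dyadic_avoid_def by blast
  then have "(\<lambda>i. measure P (dyadic_avoid (?e i) t)) \<longlonglongrightarrow> measure P (\<Union>i. dyadic_avoid (?e i) t)"
    using t by (intro finite_Lim_measure_incseq) (auto intro: dyadic_avoid_sets)
  then have "(\<lambda>i. measure P (dyadic_avoid (?e i) t)) \<longlonglongrightarrow> measure P (no_hit t)"
    by (simp only: no_hit_eq[OF t])
  moreover have "measure P (dyadic_avoid (?e i) t) \<le> u t x" for i
    using x by (intro prob_dyadic_avoid_le t) (auto simp: divide_less_eq)
  ultimately show ?thesis by (intro LIMSEQ_le_const2) auto
qed

text \<open>The strict \<open>S < t\<close> leaves remaining time at least \<open>t - S\<close>,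
  which makes the survival quotient uniformly small in a small enough ball.\<close>

lemma prob_no_hit_ge:
  assumes S: "0 < S" "S < t" "t \<le> T"
  shows "u t x \<le> measure P (no_hit S)"
proof (rule field_le_epsilon)
  fix \<eta> :: real assume \<eta>: "0 < \<eta>"
  obtain e where e: "0 < e"
    "\<And>r a. t - S \<le> r \<Longrightarrow> 0 \<le> a \<Longrightarrow> a \<le> e \<Longrightarrow> survival (real DIM('a) / 2) l r a \<le> \<eta>"
    using survival_small_near_origin[of "t - S" \<eta>] S \<eta> by auto
  define e' where "e' = min e (norm x / 2)"
  have e': "0 < e'" "e' < norm x" "e' \<le> e" using e(1) x by (auto simp: e'_def min_less_iff_disj)
  have "u t x - \<eta> \<le> measure P (dyadic_avoid e' S)"
    using S e' \<eta> by (intro prob_dyadic_avoid_ge[of S t] e(2)) auto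
  also have "\<dots> \<le> measure P (no_hit S)"
  proof (rule finite_measure_mono)
    show "no_hit S \<in> sets P" using S by (intro no_hit_sets) auto
    show "dyadic_avoid e' S \<subseteq> no_hit S"
    proof
      fix \<omega> assume \<omega>: "\<omega> \<in> dyadic_avoid e' S"
      have "\<omega> s \<noteq> 0" if "s \<in> {0..S}" for s
        using dyadic_avoid_norm_ge[OF \<omega> _ _ that] S e'(1) by auto
      moreover have "\<omega> \<in> space P" using \<omega> by (auto simp: dyadic_avoid_def grid_avoid_def)
      ultimately show "\<omega> \<in> no_hit S" by (simp add: no_hit_def)
    qed
  qed
  finally show "u t x \<le> measure P (no_hit S) + \<eta>" by simp
qed

text \<open>Given the starting point, the law at time \<open>t\<close> has a Lebesgue density, and a
  point is a null set.\<close>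

lemma AE_nonzero:
  assumes t: "0 < t" "t \<le> T"
  shows "AE \<omega> in P. \<omega> t \<noteq> 0"
proof -
  interpret F: finite_measure_subalgebra P "path_filtration T 0"
    using subalgebra_P[of 0] T by unfold_locales auto
  have [measurable]: "(\<lambda>\<omega>. \<omega> t) \<in> borel_measurable P"
    using t by (intro eval_measurable) auto
  let ?f = "\<lambda>\<omega>. indicator {0} (\<omega> t :: 'a) :: real"
  have int: "integrable P ?f"
    by (rule integrable_const_bound[where B=1]) auto
  have "AE \<omega> in P. real_cond_exp P (path_filtration T 0) ?f \<omega> = 0"
    using markov[OF order_refl t borel_closed[OF closed_singleton[of 0]]]
  proof eventually_elim
    case (elim \<omega>)
    have "(LBINT y:{0::'a}. ground_density \<gamma> (t - 0) (\<omega> 0) y) = (LBINT y::'a. 0)"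
      unfolding set_lebesgue_integral_def
    proof (rule integral_eq_zero_AE[THEN trans])
      show "AE y in lborel. indicat_real {0} y *\<^sub>R ground_density \<gamma> (t - 0) (\<omega> 0) y = 0"
        using AE_lborel_singleton[of "0::'a"] by eventually_elim simp
    qed simp
    then show ?case using elim by simp
  qed
  then have "(LINT \<omega>|P. real_cond_exp P (path_filtration T 0) ?f \<omega>) = 0"
    by (rule integral_eq_zero_AE)
  then have "(LINT \<omega>|P. ?f \<omega>) = 0"
    using F.real_cond_exp_int(2)[OF int] by simp
  then have "AE \<omega> in P. ?f \<omega> = 0"
    using int by (subst (asm) integral_nonneg_eq_0_iff_AE) auto
  then show ?thesis by eventually_elim (auto split: split_indicator_asm)
qed

text \<open>Avoiding the origin up to every \<open>S i\<close> means avoiding it on the half-open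
  interval before \<open>t\<close>. This differs from \<open>no_hit t\<close> only by paths that
  vanish at \<open>t\<close>, a null event by \<open>AE_nonzero\<close>.\<close>

lemma prob_no_hit:
  assumes t: "0 < t" "t \<le> T"
  shows "measure P (no_hit t) = u t x"
proof (rule antisym[OF prob_no_hit_le[OF t]])
  define S where "S i = t * (1 - 1 / (real i + 2))" for i
  have S: "0 < S i" "S i < t" for i using t by (auto simp: S_def)
  have mono: "S i \<le> S j" if "i \<le> j" for i j
    unfolding S_def using that t by (intro mult_left_mono diff_left_mono divide_left_mono) auto
  have dec: "decseq (\<lambda>i. no_hit (S i))"
    unfolding decseq_def
  proof (intro allI impI subsetI)
    fix i j \<omega> assume "i \<le> j" "\<omega> \<in> no_hit (S j)"
    with mono[of i j] show "\<omega> \<in> no_hit (S i)" by (auto simp: no_hit_def)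
  qed
  have sets: "no_hit (S i) \<in> sets P" for i
    using S[of i] t by (intro no_hit_sets) auto
  have "(\<lambda>i. measure P (no_hit (S i))) \<longlonglongrightarrow> measure P (\<Inter>i. no_hit (S i))"
    using sets by (intro finite_Lim_measure_decseq dec) auto
  moreover have "u t x \<le> measure P (no_hit (S i))" for i
    using S t by (intro prob_no_hit_ge) auto
  ultimately have "u t x \<le> measure P (\<Inter>i. no_hit (S i))"
    by (intro LIMSEQ_le_const) auto
  also have "\<dots> = measure P (no_hit t)"
  proof (rule measure_eq_AE)
    show "AE \<omega> in P. \<omega> \<in> (\<Inter>i. no_hit (S i)) \<longleftrightarrow> \<omega> \<in> no_hit t"
      using AE_nonzero[OF t]
    proof eventually_elim
      case (elim \<omega>)
      have "\<exists>i. s \<le> S i" if s: "0 \<le> s" "s < t" for s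
      proof -
        obtain i :: nat where "t / (t - s) < real i" using reals_Archimedean2 by blast
        then have "t / (t - s) < real i + 2" by simp
        then have "t < (t - s) * (real i + 2)" using s by (simp add: divide_less_eq mult.commute)
        then have "t / (real i + 2) < t - s" by (simp add: divide_less_eq)
        then have "s \<le> S i" by (simp add: S_def right_diff_distrib)
        then show ?thesis ..
      qed
      then show ?case
        using elim S unfolding no_hit_def
        by (auto simp: less_le) (metis less_imp_le order_trans atLeastAtMost_iff)+
    qed
    show "(\<Inter>i. no_hit (S i)) \<in> sets P" using sets by auto
    show "no_hit t \<in> sets P" using t by (intro no_hit_sets)
  qed
  finally show "u t x \<le> measure P (no_hit t)" .
qed

section \<open>The law of the hitting time\<close>

abbreviation \<tau> :: "(real \<Rightarrow> 'a) \<Rightarrow> ereal" where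
  "\<tau> \<equiv> hitting_time T"

lemma hitting_time_greater_eq:
  assumes "t \<in> {0..T}"
  shows "{\<omega> \<in> space P. ereal t < \<tau> \<omega>} = no_hit t"
  using hitting_time_greater_iff[OF path_continuous_P _] assms by (auto simp: no_hit_def)

lemma hitting_time_values:
  assumes "\<omega> \<in> space P"
  obtains "\<tau> \<omega> = \<infinity>" | m where "m \<in> {0..T}" "\<tau> \<omega> = ereal m"
  using hitting_time_cases[OF path_continuous_P[OF assms]] by metis

lemma prob_hitting_time_greater:
  assumes t: "t \<in> {0..T}"
  shows "{\<omega> \<in> space P. ereal t < \<tau> \<omega>} \<in> sets P"
    and "measure P {\<omega> \<in> space P. ereal t < \<tau> \<omega>} = u t x"
proof -
  have "no_hit t \<in> sets P \<and> measure P (no_hit t) = u t x"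
  proof (cases "t = 0")
    case True
    have "no_hit t = (\<lambda>\<omega>. \<omega> 0) -` (- {0}) \<inter> space P"
      using True by (auto simp: no_hit_def)
    then have sets: "no_hit t \<in> sets P"
      using T by (auto intro!: measurable_sets[OF eval_measurable])
    have "AE \<omega> in P. \<omega> \<in> no_hit t"
      using AE_start AE_space by eventually_elim (use x True in \<open>auto simp: no_hit_def\<close>)
    with sets have "measure P (no_hit t) = 1" by (simp add: prob_eq_1)
    with sets True x show ?thesis by (simp add: survival_zero)
  next
    case False
    with t show ?thesis by (auto intro!: no_hit_sets prob_no_hit)
  qed
  then show "{\<omega> \<in> space P. ereal t < \<tau> \<omega>} \<in> sets P"
    "measure P {\<omega> \<in> space P. ereal t < \<tau> \<omega>} = u t x"
    by (simp_all add: hitting_time_greater_eq[OF t])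
qed

text \<open>No value lies strictly between \<open>T\<close> and infinity, so thresholds beyond
  \<open>T\<close> reduce to \<open>T\<close>; negative thresholds give the whole space.\<close>

lemma hitting_time_measurable: "\<tau> \<in> borel_measurable P"
proof (rule borel_measurableI_greater)
  fix a :: ereal
  have *: "ereal t < \<tau> \<omega> \<longleftrightarrow> ereal T < \<tau> \<omega>" if "\<omega> \<in> space P" "T \<le> t" for \<omega> t
    using that(1)
  proof (cases rule: hitting_time_values)
    case 1
    then show ?thesis by simp
  next
    case (2 m)
    then show ?thesis using that(2) by simp
  qed
  have nonneg: "0 \<le> \<tau> \<omega>" if "\<omega> \<in> space P" for \<omega>
    by (rule hitting_time_values[OF that]) auto
  show "{\<omega> \<in> space P. a < \<tau> \<omega>} \<in> sets P"
  proof (cases a)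
    case (real t)
    show ?thesis
    proof (cases "t < 0")
      case True
      then have "{\<omega> \<in> space P. a < \<tau> \<omega>} = space P"
        using real by (auto intro: less_le_trans[OF _ nonneg])
      then show ?thesis by simp
    next
      case False
      have "a < \<tau> \<omega> \<longleftrightarrow> ereal (min t T) < \<tau> \<omega>" if "\<omega> \<in> space P" for \<omega>
      proof (cases "t \<le> T")
        case True
        then show ?thesis using real by simp
      next
        case False
        then show ?thesis using *[OF that, of t] real by simp
      qed
      then have "{\<omega> \<in> space P. a < \<tau> \<omega>} = {\<omega> \<in> space P. ereal (min t T) < \<tau> \<omega>}"
        by blast
      then show ?thesis using False T prob_hitting_time_greater(1)[of "min t T"] by simp
    qed
  next
    case PInf
    then show ?thesis by simp
  next
    case MInf
    have "- \<infinity> < \<tau> \<omega>" if "\<omega> \<in> space P" for \<omega>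
      by (rule less_le_trans[OF _ nonneg[OF that]]) simp
    with MInf have "{\<omega> \<in> space P. a < \<tau> \<omega>} = space P" by auto
    then show ?thesis by simp
  qed
qed

text \<open>Ensures that the conditioning event in (ii) has positive probability and that the
  normalising difference is nonzero.\<close>

lemma survival_less_one:
  assumes "0 < t"
  shows "u t x < 1"
proof -
  have pos: "0 < W 0 x" using x by (intro tail_weight_pos) auto
  have "W t x < W 0 x"
  proof (rule ccontr)
    assume "\<not> W t x < W 0 x"
    then have "W 0 x - W t x = 0" using tail_weight_antimono[of 0 t "norm x"] assms x by simp
    then have "(LBINT r:{0<..t}. hit_weight (real DIM('a) / 2) l (norm x) r) = 0"
      using tail_weight_diff[of 0 t "norm x"] assms x by simp
    moreover have "set_integrable lborel {0<..t} (hit_weight (real DIM('a) / 2) l (norm x))"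
      using x by (intro integrable_tail_subset[of 0]) auto
    ultimately have "AE r in lborel. indicator {0<..t} r * hit_weight (real DIM('a) / 2) l (norm x) r = 0"
      unfolding set_lebesgue_integral_def set_integrable_def
      by (subst (asm) integral_nonneg_eq_0_iff_AE) auto
    then have "AE r in lborel. r \<notin> {0<..t}"
      by eventually_elim (auto simp: hit_weight_def split: split_indicator_asm)
    then have "emeasure lborel {0<..t} = 0"
      by (subst (asm) AE_iff_measurable[where N="{0<..t}"]) auto
    then show False using assms by simp
  qed
  then show ?thesis using pos x by (simp add: survival_def)
qed

lemma bessel_ratio:
  assumes "0 \<le> s"
  shows "inc_bessel_K (real DIM('a) / 2 - 1) (sqrt (2 * l) * norm x) (l * s) =
    1 / 2 * (norm x / sqrt (2 * l)) powr (real DIM('a) / 2 - 1) * W s x"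
  using inc_bessel_K_eq_tail_weight[OF l, of "norm x" s] x assms by simp

text \<open>Differences of survival probabilities are differences of tail integrals, hence integrals
  of \<open>hit_weight\<close> over an interval. This matches the two measures on all upper
  half-lines, which determine a finite Borel measure.\<close>

lemma conditional_hitting_time_density:
  "distributed (uniform_measure P {\<omega> \<in> space P. \<tau> \<omega> \<le> ereal T}) lborel (\<lambda>\<omega>. real_of_ereal (\<tau> \<omega>))
     (\<lambda>t. ennreal (indicator {0<..T} t * (hit_weight (real DIM('a) / 2) l (norm x) t / (W 0 x - W T x))))"
proof -
  let ?A = "{\<omega> \<in> space P. \<tau> \<omega> \<le> ereal T}"
  let ?U = "uniform_measure P ?A"
  let ?Y = "\<lambda>\<omega>. real_of_ereal (\<tau> \<omega>)"
  let ?h = "hit_weight (real DIM('a) / 2) l (norm x)"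
  let ?f = "\<lambda>t. ennreal (indicator {0<..T} t * (?h t / (W 0 x - W T x)))"
  note [measurable] = hitting_time_measurable
  have W0: "0 < W 0 x" using x by (intro tail_weight_pos) auto
  have uW: "u s x = W s x / W 0 x" for s using x by (simp add: survival_def)
  have D: "0 < W 0 x - W T x"
    using survival_less_one[OF T] W0 by (simp add: uW divide_less_eq)
  have A [measurable]: "?A \<in> sets P" by measurable
  have PA: "measure P ?A = 1 - u T x"
  proof -
    have "?A = space P - {\<omega> \<in> space P. ereal T < \<tau> \<omega>}" by auto
    then show ?thesis using prob_compl[OF prob_hitting_time_greater(1)[of T]] prob_hitting_time_greater(2)[of T] T by simp
  qed
  have eq: "emeasure (distr ?U lborel ?Y) {a<..} = emeasure (density lborel ?f) {a<..}" for a
  proof (cases "a < T")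
    case True
    \<comment> \<open>Survival probabilities are known only for times in \<open>{0..T}\<close>, so
      negative thresholds are moved to 0.\<close>
    define b where "b = max a 0"
    have b: "b \<in> {0..T}" using True T by (auto simp: b_def)
    have val: "\<omega> \<in> ?A \<Longrightarrow> ereal b < \<tau> \<omega> \<Longrightarrow> a < ?Y \<omega>" for \<omega>
      by (auto elim!: hitting_time_values simp: b_def)
    have "emeasure (distr ?U lborel ?Y) {a<..} = emeasure P (?A \<inter> {\<omega> \<in> space P. a < ?Y \<omega>}) / emeasure P ?A"
      by (subst emeasure_distr) (auto simp: emeasure_uniform_measure[OF A] vimage_def Int_def conj_commute
          intro!: arg_cong2[where f="(/)"] arg_cong2[where f=emeasure])
    also have "emeasure P (?A \<inter> {\<omega> \<in> space P. a < ?Y \<omega>}) = emeasure P ({\<omega> \<in> space P. ereal b < \<tau> \<omega>} - {\<omega> \<in> space P. ereal T < \<tau> \<omega>})"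
    proof (rule emeasure_eq_AE)
      \<comment> \<open>For negative \<open>a\<close> the two events differ by paths with hitting
        time 0, which are excluded almost surely since the start \<open>x\<close> is
        nonzero.\<close>
      have "AE \<omega> in P. \<omega> \<in> no_hit 0"
        using AE_start AE_space by eventually_elim (use x in \<open>auto simp: no_hit_def\<close>)
      then have "AE \<omega> in P. ereal 0 < \<tau> \<omega>"
        using T by (auto simp: hitting_time_greater_eq[of 0, symmetric] elim: eventually_mono)
      then show "AE \<omega> in P. \<omega> \<in> ?A \<inter> {\<omega> \<in> space P. a < ?Y \<omega>} \<longleftrightarrow>
          \<omega> \<in> {\<omega> \<in> space P. ereal b < \<tau> \<omega>} - {\<omega> \<in> space P. ereal T < \<tau> \<omega>}"
        using AE_space
      proof eventually_elim
        case (elim \<omega>)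
        from elim(2) show ?case
        proof (cases rule: hitting_time_values)
          case 1
          then show ?thesis by simp
        next
          case (2 m)
          then show ?thesis using elim(1) by (auto simp: b_def)
        qed
      qed
      show "?A \<inter> {\<omega> \<in> space P. a < ?Y \<omega>} \<in> sets P"
        "{\<omega> \<in> space P. ereal b < \<tau> \<omega>} - {\<omega> \<in> space P. ereal T < \<tau> \<omega>} \<in> sets P" by measurable
    qed
    also have "\<dots> = ennreal (u b x - u T x)"
    proof -
      have "measure P ({\<omega> \<in> space P. ereal b < \<tau> \<omega>} - {\<omega> \<in> space P. ereal T < \<tau> \<omega>}) = u b x - u T x"
        using prob_hitting_time_greater[OF b] prob_hitting_time_greater[of T] T b
        by (subst finite_measure_Diff) (auto intro: order.strict_trans1[of "ereal b" "ereal T"])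
      then show ?thesis by (simp add: emeasure_eq_measure)
    qed
    also have "ennreal (u b x - u T x) / emeasure P ?A = ennreal ((u b x - u T x) / (1 - u T x))"
      using survival_less_one[OF T] survival_antimono[of b T "norm x"] b
      by (simp add: emeasure_eq_measure PA divide_ennreal)
    also have "(u b x - u T x) / (1 - u T x) = (W b x - W T x) / (W 0 x - W T x)"
      using W0 D by (simp add: uW field_simps)
    also have "\<dots> = (LBINT r:{b<..T}. ?h r) / (W 0 x - W T x)"
      using tail_weight_diff[of b T "norm x"] b x by simp
    also have "\<dots> = (LBINT r. indicator {b<..T} r * (?h r / (W 0 x - W T x)))"
      by (simp add: set_lebesgue_integral_def)
    also have "ennreal \<dots> = (\<integral>\<^sup>+r. ennreal (indicator {b<..T} r * (?h r / (W 0 x - W T x))) \<partial>lborel)"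
    proof (rule nn_integral_eq_integral[symmetric])
      have "set_integrable lborel {b<..T} ?h"
        using b x by (intro integrable_tail_subset[of 0]) auto
      then show "integrable lborel (\<lambda>r. indicator {b<..T} r * (?h r / (W 0 x - W T x)))"
        by (simp add: set_integrable_def)
    qed (use D in auto)
    also have "\<dots> = (\<integral>\<^sup>+r. ?f r * indicator {a<..} r \<partial>lborel)"
      by (intro nn_integral_cong) (auto simp: b_def split: split_indicator)
    also have "\<dots> = emeasure (density lborel ?f) {a<..}"
      by (simp add: emeasure_density)
    finally show ?thesis .
  next
    case False
    have "emeasure (density lborel ?f) {a<..} = (\<integral>\<^sup>+r. ?f r * indicator {a<..} r \<partial>lborel)"
      by (rule emeasure_density) auto
    also have "\<dots> = (\<integral>\<^sup>+r. 0 \<partial>(lborel :: real measure))"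
      by (intro nn_integral_cong) (use False in \<open>auto split: split_indicator\<close>)
    finally have "emeasure (density lborel ?f) {a<..} = 0" by simp
    moreover have "emeasure (distr ?U lborel ?Y) {a<..} = emeasure P (?A \<inter> (?Y -` {a<..} \<inter> space P)) / emeasure P ?A"
      by (subst emeasure_distr) (auto simp: emeasure_uniform_measure)
    moreover have "?A \<inter> (?Y -` {a<..} \<inter> space P) = {}"
      using False T by (auto elim!: hitting_time_values)
    ultimately show ?thesis by simp
  qed
  have "prob_space ?U"
    using PA survival_less_one[OF T] by (intro prob_space_uniform_measure) (auto simp: emeasure_eq_measure)
  then interpret U: prob_space ?U .
  have Y: "?Y \<in> measurable ?U lborel" by measurable
  interpret Y: prob_space "distr ?U lborel ?Y" by (rule U.prob_space_distr[OF Y])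
  have "distr ?U lborel ?Y = density lborel ?f"
  proof (rule measure_eqI_lessThan)
    show "emeasure (distr ?U lborel ?Y) {a<..} < \<infinity>" for a
      by (simp add: Y.emeasure_eq_measure)
  qed (simp_all only: eq sets_distr sets_density sets_lborel)
  then show ?thesis
    unfolding distributed_def using Y by simp
qed

end

theorem corollary1p5:
  fixes T \<gamma> :: real
    and x :: "'a::euclidean_space"
    and P :: "(real \<Rightarrow> 'a) measure"
  defines "\<nu> \<equiv> real DIM('a) / 2 - 1"
    and "lam \<equiv> ground_energy DIM('a) \<gamma>"
  assumes dim: "DIM('a) \<in> {2, 3}"
    and T: "0 < T"
    and gamma: "0 < \<gamma>"
    and x: "x \<noteq> 0"
    and P: "ground_state_diffusion T \<gamma> x P"
  shows "\<P>(\<omega> in P. hitting_time T \<omega> > ereal T) =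
           inc_bessel_K \<nu> (sqrt (2 * lam) * norm x) (lam * T) /
           bessel_K \<nu> (sqrt (2 * lam) * norm x)
       \<and>
         distributed
           (uniform_measure P {\<omega> \<in> space P. hitting_time T \<omega> \<le> ereal T})
           lborel
           (\<lambda>\<omega>. real_of_ereal (hitting_time T \<omega>))
           (\<lambda>t. ennreal (indicator {0<..T} t *
              ((norm x / sqrt (2 * lam)) powr \<nu> /
                 (bessel_K \<nu> (sqrt (2 * lam) * norm x) -
                  inc_bessel_K \<nu> (sqrt (2 * lam) * norm x) (lam * T)) *
               (1 / (2 * t powr (real DIM('a) / 2))) *
               exp (- lam * t - (norm x)\<^sup>2 / (2 * t)))))"
proof -
  interpret ground_diffusion \<gamma> lam x T P
    using dim T gamma x P by unfold_locales (auto simp: lam_def)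
  \<comment> \<open>Both Bessel functions carry the factor \<open>1 / 2 * ?c\<close>. It cancels in
    the quotient of (i); in (ii) its two parts cancel against the numerator \<open>?c\<close> and
    the 2 in \<open>2 * t powr (real DIM('a) / 2)\<close>.\<close>
  let ?c = "(norm x / sqrt (2 * lam)) powr \<nu>"
  have c: "0 < ?c" using x l by simp
  have K: "inc_bessel_K \<nu> (sqrt (2 * lam) * norm x) (lam * T) = 1 / 2 * ?c * W T x"
    "bessel_K \<nu> (sqrt (2 * lam) * norm x) = 1 / 2 * ?c * W 0 x"
    using bessel_ratio[of T] bessel_ratio[of 0] T by (simp_all add: bessel_K_def \<nu>_def)
  have "\<P>(\<omega> in P. hitting_time T \<omega> > ereal T) = u T x"
    using prob_hitting_time_greater(2)[of T] T by simp
  moreover have "u T x = inc_bessel_K \<nu> (sqrt (2 * lam) * norm x) (lam * T) / bessel_K \<nu> (sqrt (2 * lam) * norm x)"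
    using c x unfolding K by (simp add: survival_def)
  moreover have "?c / (1 / 2 * ?c * W 0 x - 1 / 2 * ?c * W T x) * (1 / (2 * t powr (real DIM('a) / 2))) *
      exp (- lam * t - (norm x)\<^sup>2 / (2 * t)) = hit_weight (real DIM('a) / 2) lam (norm x) t / (W 0 x - W T x)" for t
  proof -
    have eq: "1 / 2 * ?c * W 0 x - 1 / 2 * ?c * W T x = ?c * (W 0 x - W T x) / 2" by (simp add: algebra_simps)
    show ?thesis
      unfolding eq using c by (simp add: hit_weight_def powr_minus_divide)
  qed
  ultimately show ?thesis
    using conditional_hitting_time_density unfolding K by simp
qed
end
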